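(* Let $\phi$ be an $\mathcal{L}_{[<\omega]}$-formula. Then the following are equivalent: (2) $\phi$ is a theorem of $\mathsf{GLP}.3$; (3) every closed substitution of $\phi$ is a theorem of $\mathsf{GLP}$; (4) $\phi$ is a theorem of some non-degenerate, normal extension of $\mathsf{GLP}$.
   Context: $\mathcal{L}_{[<\omega]}$ is the propositional language with propositional variables, the constant $\top$ (with $\bot := \lnot\top$), Boolean connectives, and modal operators $[n]$ for $n\in\mathbb{N}$, with duals $\langle n\rangle := \lnot[n]\lnot$. A formula is closed if it contains no propositional variables; a closed substitution of $\phi$ is obtained by substituting a closed formula for each propositional variable of $\phi$. $\mathsf{GLP}$ is the logic whose axioms are all propositional tautologies and, for each $n$: $[n](\phi\to\psi)\to([n]\phi\to[n]\psi)$; $[n]([n]\phi\to\phi)\to[n]\phi$; $[n]\phi\to[n+1]\phi$; $\langle n\rangle\phi\to[n+1]\langle n\rangle\phi$; closed under modus ponens and necessitation for every $[n]$. $\mathsf{GLP}.3$ is $\mathsf{GLP}$ plus the axioms $[n]([n]A\to B)\vee[n]([n]B\wedge B\to A)$ for all $n$ and formulas $A,B$. A normal extension of $\mathsf{GLP}$ is a modal logic (a set of formulas closed under uniform substitution) containing $\mathsf{GLP}$ and closed under modus ponens and necessitation for every $[n]$. A modal logic is non-degenerate if it does not contain $[m]^k\bot$ for any modality $[m]$ and any $k\in\mathbb{N}$. *)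

theory Defs
  imports Main
begin

datatype fm =
    Var nat
  | Verum                ("\<^bold>\<top>")
  | Neg fm               ("\<^bold>\<not> _" [70] 70)
  | Conj fm fm           (infixr "\<^bold>\<and>" 65)
  | Disj fm fm           (infixr "\<^bold>\<or>" 60)
  | Imp fm fm            (infixr "\<^bold>\<rightarrow>" 55)
  | Box nat fm           ("\<^bold>[_\<^bold>] _" [0, 70] 70)

abbreviation Falsum :: fm ("\<^bold>\<bottom>") where
  "\<^bold>\<bottom> \<equiv> \<^bold>\<not> \<^bold>\<top>"

abbreviation Dia :: "nat \<Rightarrow> fm \<Rightarrow> fm" ("\<^bold>\<langle>_\<^bold>\<rangle> _" [0, 70] 70) where
  "\<^bold>\<langle>n\<^bold>\<rangle> \<phi> \<equiv> \<^bold>\<not> \<^bold>[n\<^bold>] \<^bold>\<not> \<phi>"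

primrec vars :: "fm \<Rightarrow> nat set" where
  "vars (Var p) = {p}"
| "vars \<^bold>\<top> = {}"
| "vars (\<^bold>\<not> \<phi>) = vars \<phi>"
| "vars (\<phi> \<^bold>\<and> \<psi>) = vars \<phi> \<union> vars \<psi>"
| "vars (\<phi> \<^bold>\<or> \<psi>) = vars \<phi> \<union> vars \<psi>"
| "vars (\<phi> \<^bold>\<rightarrow> \<psi>) = vars \<phi> \<union> vars \<psi>"
| "vars (\<^bold>[n\<^bold>] \<phi>) = vars \<phi>"

primrec subst :: "(nat \<Rightarrow> fm) \<Rightarrow> fm \<Rightarrow> fm" where
  "subst \<sigma> (Var p) = \<sigma> p"
| "subst \<sigma> \<^bold>\<top> = \<^bold>\<top>"
| "subst \<sigma> (\<^bold>\<not> \<phi>) = \<^bold>\<not> subst \<sigma> \<phi>"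
| "subst \<sigma> (\<phi> \<^bold>\<and> \<psi>) = subst \<sigma> \<phi> \<^bold>\<and> subst \<sigma> \<psi>"
| "subst \<sigma> (\<phi> \<^bold>\<or> \<psi>) = subst \<sigma> \<phi> \<^bold>\<or> subst \<sigma> \<psi>"
| "subst \<sigma> (\<phi> \<^bold>\<rightarrow> \<psi>) = subst \<sigma> \<phi> \<^bold>\<rightarrow> subst \<sigma> \<psi>"
| "subst \<sigma> (\<^bold>[n\<^bold>] \<phi>) = \<^bold>[n\<^bold>] subst \<sigma> \<phi>"

definition closed_fm :: "fm \<Rightarrow> bool" where
  "closed_fm \<phi> \<longleftrightarrow> vars \<phi> = {}"

definition closed_substitutions :: "fm \<Rightarrow> fm set" where
  "closed_substitutions \<phi> = {subst \<sigma> \<phi> | \<sigma>. \<forall>p \<in> vars \<phi>. closed_fm (\<sigma> p)}"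

(* For propositional purposes, variables and boxed formulas alike are atoms,
   so a valuation assigns a truth value to each of them independently. *)
primrec prop_eval :: "(fm \<Rightarrow> bool) \<Rightarrow> fm \<Rightarrow> bool" where
  "prop_eval V (Var p) \<longleftrightarrow> V (Var p)"
| "prop_eval V \<^bold>\<top> \<longleftrightarrow> True"
| "prop_eval V (\<^bold>\<not> \<phi>) \<longleftrightarrow> \<not> prop_eval V \<phi>"
| "prop_eval V (\<phi> \<^bold>\<and> \<psi>) \<longleftrightarrow> prop_eval V \<phi> \<and> prop_eval V \<psi>"
| "prop_eval V (\<phi> \<^bold>\<or> \<psi>) \<longleftrightarrow> prop_eval V \<phi> \<or> prop_eval V \<psi>"
| "prop_eval V (\<phi> \<^bold>\<rightarrow> \<psi>) \<longleftrightarrow> (prop_eval V \<phi> \<longrightarrow> prop_eval V \<psi>)"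
| "prop_eval V (\<^bold>[n\<^bold>] \<phi>) \<longleftrightarrow> V (\<^bold>[n\<^bold>] \<phi>)"

definition tautology :: "fm \<Rightarrow> bool" where
  "tautology \<phi> \<longleftrightarrow> (\<forall>V. prop_eval V \<phi>)"

inductive_set GLP_axioms :: "fm set" where
  Taut: "tautology \<phi> \<Longrightarrow> \<phi> \<in> GLP_axioms"
| K: "\<^bold>[n\<^bold>] (\<phi> \<^bold>\<rightarrow> \<psi>) \<^bold>\<rightarrow> (\<^bold>[n\<^bold>] \<phi> \<^bold>\<rightarrow> \<^bold>[n\<^bold>] \<psi>) \<in> GLP_axioms"
| Loeb: "\<^bold>[n\<^bold>] (\<^bold>[n\<^bold>] \<phi> \<^bold>\<rightarrow> \<phi>) \<^bold>\<rightarrow> \<^bold>[n\<^bold>] \<phi> \<in> GLP_axioms"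
| Mono: "\<^bold>[n\<^bold>] \<phi> \<^bold>\<rightarrow> \<^bold>[n + 1\<^bold>] \<phi> \<in> GLP_axioms"
| Dia_Box: "\<^bold>\<langle>n\<^bold>\<rangle> \<phi> \<^bold>\<rightarrow> \<^bold>[n + 1\<^bold>] \<^bold>\<langle>n\<^bold>\<rangle> \<phi> \<in> GLP_axioms"

inductive_set dot3_axioms :: "fm set" where
  Dot3: "\<^bold>[n\<^bold>] (\<^bold>[n\<^bold>] A \<^bold>\<rightarrow> B) \<^bold>\<or> \<^bold>[n\<^bold>] (\<^bold>[n\<^bold>] B \<^bold>\<and> B \<^bold>\<rightarrow> A) \<in> dot3_axioms"

inductive_set theorems_of :: "fm set \<Rightarrow> fm set" for Ax :: "fm set" where
  Ax: "\<phi> \<in> Ax \<Longrightarrow> \<phi> \<in> theorems_of Ax"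
| MP: "\<phi> \<^bold>\<rightarrow> \<psi> \<in> theorems_of Ax \<Longrightarrow> \<phi> \<in> theorems_of Ax \<Longrightarrow> \<psi> \<in> theorems_of Ax"
| Nec: "\<phi> \<in> theorems_of Ax \<Longrightarrow> \<^bold>[n\<^bold>] \<phi> \<in> theorems_of Ax"

definition GLP :: "fm set" where
  "GLP = theorems_of GLP_axioms"

definition GLP3 :: "fm set" where
  "GLP3 = theorems_of (GLP_axioms \<union> dot3_axioms)"

definition modal_logic :: "fm set \<Rightarrow> bool" where
  "modal_logic L \<longleftrightarrow> (\<forall>\<phi> \<in> L. \<forall>\<sigma>. subst \<sigma> \<phi> \<in> L)"

definition normal_extension_of_GLP :: "fm set \<Rightarrow> bool" where
  "normal_extension_of_GLP L \<longleftrightarrow>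
     modal_logic L \<and> GLP \<subseteq> L \<and>
     (\<forall>\<phi> \<psi>. \<phi> \<^bold>\<rightarrow> \<psi> \<in> L \<longrightarrow> \<phi> \<in> L \<longrightarrow> \<psi> \<in> L) \<and>
     (\<forall>\<phi> n. \<phi> \<in> L \<longrightarrow> \<^bold>[n\<^bold>] \<phi> \<in> L)"

(* The case k = 0 excludes the inconsistent logic. *)
definition non_degenerate :: "fm set \<Rightarrow> bool" where
  "non_degenerate L \<longleftrightarrow> (\<forall>m k. (Box m ^^ k) \<^bold>\<bottom> \<notin> L)"

end

(* GLP.3 is complete for finite linearly ordered sets of maximal consistent sets. By recursion on
   the modalities, such a set is simulated by closed formulas in GLP, as in Solovay's proof of
   arithmetical completeness: if GLP.3 does not prove phi, some closed substitution of phi is refuted,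
   provably in GLP, at a point below <m>T. So no logic that avoids [m]F contains phi. Conversely, GLP
   proves all closed instances of the linearity axiom, because the least point of a consistent closed
   formula is the least point of a worm, and worms are linearly ordered. GLP itself avoids [m]^k F by
   a version of Ignatiev's model over the countable ordinals. All derivations in GLP are replaced by
   arguments about the frame of its maximal consistent sets. *)

theory Submission
  imports Defs "HOL-Library.Countable_Set"
begin

section \<open>Canonical models of normal extensions of GLP\<close>

text \<open>\<open>GLP\<close> is not complete for any class of Kripke frames, and the canonical
  relations are not conversely well founded. Loeb's axiom is therefore available for one formula at
  a time only: a reachable formula is reachable at some point beyond which it fails. Every
  minimality argument has to pass through such a formula, which is why closed formulas are compared
  by their least points and why the simulated worlds need explicit descriptions. The second tool is
  rigidity: points related by a modality above n agree on all n-boxes. A world and its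
  (n+1)-successors thus share their n-successors, so a structure for the modalities from n on can be
  glued from one for those from n+1 on and another one that lies further along n. The locale is
  stated for an arbitrary \<open>L\<close> because the same frame theory serves \<open>GLP\<close>,
  where the closed formulas are evaluated, and \<open>GLP3\<close>, which supplies the worlds to be
  simulated. Non-degeneracy needs no ordinal notations: a well-order with countable initial segments
  in which countable sets are bounded has enough suprema to carry a rank function with arbitrarily
  large values.\<close>

locale glp_logic =
  fixes L :: "fm set"
  assumes GLP_subset: "GLP \<subseteq> L"
    and MP: "\<phi> \<^bold>\<rightarrow> \<psi> \<in> L \<Longrightarrow> \<phi> \<in> L \<Longrightarrow> \<psi> \<in> L"
    and Nec: "\<phi> \<in> L \<Longrightarrow> \<^bold>[n\<^bold>] \<phi> \<in> L"
begin

section \<open>Deductive sets and maximal consistent sets\<close>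

lemma axiom: "\<phi> \<in> GLP_axioms \<Longrightarrow> \<phi> \<in> L"
  using GLP_subset by (auto simp: GLP_def intro: theorems_of.Ax)

text \<open>Closure under necessitation is left out on purpose: the formulas boxed at a world, or an
  extension by one hypothesis, are closed under modus ponens only.\<close>

definition deductive :: "fm set \<Rightarrow> bool" where
  "deductive T \<longleftrightarrow> L \<subseteq> T \<and> (\<forall>\<phi> \<psi>. \<phi> \<^bold>\<rightarrow> \<psi> \<in> T \<longrightarrow> \<phi> \<in> T \<longrightarrow> \<psi> \<in> T)"

definition mcs :: "fm set \<Rightarrow> bool" where
  "mcs x \<longleftrightarrow> deductive x \<and> (\<forall>\<phi>. \<^bold>\<not> \<phi> \<in> x \<longleftrightarrow> \<phi> \<notin> x)"

lemma deductive_L: "deductive L"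
  by (auto simp: deductive_def intro: MP)

lemma deductive_MP: "deductive T \<Longrightarrow> \<phi> \<^bold>\<rightarrow> \<psi> \<in> T \<Longrightarrow> \<phi> \<in> T \<Longrightarrow> \<psi> \<in> T"
  by (auto simp: deductive_def)

lemma deductive_taut: "deductive T \<Longrightarrow> tautology \<phi> \<Longrightarrow> \<phi> \<in> T"
  using axiom[OF GLP_axioms.Taut] by (auto simp: deductive_def)

lemma deductive_taut1: "deductive T \<Longrightarrow> tautology (\<phi> \<^bold>\<rightarrow> \<psi>) \<Longrightarrow> \<phi> \<in> T \<Longrightarrow> \<psi> \<in> T"
  using deductive_taut deductive_MP by blast

lemma deductive_taut2:
  "deductive T \<Longrightarrow> tautology (\<phi> \<^bold>\<rightarrow> \<psi> \<^bold>\<rightarrow> \<chi>) \<Longrightarrow> \<phi> \<in> T \<Longrightarrow> \<psi> \<in> T \<Longrightarrow> \<chi> \<in> T"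
  using deductive_taut deductive_MP by blast

lemma Lindenbaum:
  assumes "deductive T" "\<phi> \<notin> T"
  shows "\<exists>x. mcs x \<and> T \<subseteq> x \<and> \<phi> \<notin> x"
proof -
  let ?A = "{D. deductive D \<and> T \<subseteq> D \<and> \<phi> \<notin> D}"
  have "\<exists>M\<in>?A. \<forall>X\<in>?A. M \<subseteq> X \<longrightarrow> X = M"
  proof (rule subset_Zorn_nonempty)
    show "?A \<noteq> {}" using assms by auto
  next
    fix C assume ne: "C \<noteq> {}" and ch: "subset.chain ?A C"
    have C: "D \<in> ?A" if "D \<in> C" for D
      using ch that by (auto simp: subset_chain_def)
    have "\<psi> \<in> \<Union>C" if "\<chi> \<^bold>\<rightarrow> \<psi> \<in> \<Union>C" "\<chi> \<in> \<Union>C" for \<chi> \<psi>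
    proof -
      obtain D1 D2 where D: "D1 \<in> C" "D2 \<in> C" "\<chi> \<^bold>\<rightarrow> \<psi> \<in> D1" "\<chi> \<in> D2" using \<open>\<chi> \<^bold>\<rightarrow> \<psi> \<in> \<Union>C\<close> \<open>\<chi> \<in> \<Union>C\<close> by auto
      have "D1 \<subseteq> D2 \<or> D2 \<subseteq> D1" using ch D by (auto simp: subset_chain_def)
      then obtain D where "D \<in> C" "\<chi> \<^bold>\<rightarrow> \<psi> \<in> D" "\<chi> \<in> D" using D by blast
      then show ?thesis using C deductive_MP by blast
    qed
    moreover have "L \<subseteq> \<Union>C" "T \<subseteq> \<Union>C" using ne C by (fastforce simp: deductive_def)+
    moreover have "\<phi> \<notin> \<Union>C" using C by blast
    ultimately show "\<Union>C \<in> ?A" unfolding deductive_def by blast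
  qed
  then obtain x where x: "deductive x" "T \<subseteq> x" "\<phi> \<notin> x"
    and maximal: "\<And>X. deductive X \<Longrightarrow> T \<subseteq> X \<Longrightarrow> \<phi> \<notin> X \<Longrightarrow> x \<subseteq> X \<Longrightarrow> X = x"
    by auto
  \<comment> \<open>The set \<open>?X\<close> is the deductive closure of \<open>x\<close> with
    \<open>\<psi>\<close> added (deduction theorem). If it omitted \<open>\<phi>\<close>, maximality
    would force it to equal \<open>x\<close>, although it contains \<open>\<psi>\<close>.\<close>
  have ext: "\<psi> \<^bold>\<rightarrow> \<phi> \<in> x" if "\<psi> \<notin> x" for \<psi>
  proof (rule ccontr)
    assume n: "\<psi> \<^bold>\<rightarrow> \<phi> \<notin> x"
    let ?X = "{\<chi>. \<psi> \<^bold>\<rightarrow> \<chi> \<in> x}"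
    have sub: "x \<subseteq> ?X"
      using deductive_taut1[OF x(1), of \<chi> "\<psi> \<^bold>\<rightarrow> \<chi>" for \<chi>] by (auto simp: tautology_def)
    moreover have "deductive ?X"
      unfolding deductive_def
    proof (intro conjI allI impI)
      show "L \<subseteq> ?X" using sub x(1) by (auto simp: deductive_def)
    next
      fix a b assume "a \<^bold>\<rightarrow> b \<in> ?X" "a \<in> ?X"
      then show "b \<in> ?X"
        using deductive_taut2[OF x(1), of "\<psi> \<^bold>\<rightarrow> a \<^bold>\<rightarrow> b" "\<psi> \<^bold>\<rightarrow> a" "\<psi> \<^bold>\<rightarrow> b"] by (auto simp: tautology_def)
    qed
    ultimately have "?X = x" using maximal[of ?X] x n by auto
    moreover have "\<psi> \<in> ?X" using deductive_taut[OF x(1)] by (auto simp: tautology_def)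
    ultimately show False using that by blast
  qed
  have both: "\<psi> \<in> x \<Longrightarrow> \<^bold>\<not> \<psi> \<in> x \<Longrightarrow> False" for \<psi>
    using deductive_taut2[OF x(1), of "\<^bold>\<not> \<psi>" \<psi> \<phi>] x(3) by (simp add: tautology_def)
  have one: "\<^bold>\<not> \<psi> \<in> x" if "\<psi> \<notin> x" for \<psi>
  proof (rule ccontr)
    assume "\<^bold>\<not> \<psi> \<notin> x"
    then show False
      using deductive_taut2[OF x(1) _ ext[OF that] ext, of "\<^bold>\<not> \<psi>" \<phi>] x(3)
        \<open>\<^bold>\<not> \<psi> \<notin> x\<close>
      by (auto simp: tautology_def)
  qed
  have "mcs x" unfolding mcs_def using x(1) both one by blast
  then show ?thesis using x by blast
qed

lemma mcs_L: "mcs x \<Longrightarrow> \<phi> \<in> L \<Longrightarrow> \<phi> \<in> x"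
  by (auto simp: mcs_def deductive_def)

lemma L_iff_mcs: "\<phi> \<in> L \<longleftrightarrow> (\<forall>x. mcs x \<longrightarrow> \<phi> \<in> x)"
  using mcs_L Lindenbaum[OF deductive_L] by blast

lemma mcs_taut: "mcs x \<Longrightarrow> tautology \<phi> \<Longrightarrow> \<phi> \<in> x"
  using deductive_taut by (auto simp: mcs_def)

lemma mcs_Neg [simp]: "mcs x \<Longrightarrow> \<^bold>\<not> \<phi> \<in> x \<longleftrightarrow> \<phi> \<notin> x"
  by (auto simp: mcs_def)

lemma mcs_Verum [simp]: "mcs x \<Longrightarrow> \<^bold>\<top> \<in> x"
  by (rule mcs_taut) (auto simp: tautology_def)

lemma mcs_Imp [simp]: "mcs x \<Longrightarrow> \<phi> \<^bold>\<rightarrow> \<psi> \<in> x \<longleftrightarrow> (\<phi> \<in> x \<longrightarrow> \<psi> \<in> x)"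
  using deductive_MP[of x \<phi> \<psi>] deductive_taut1[of x \<psi> "\<phi> \<^bold>\<rightarrow> \<psi>"] deductive_taut1[of x "\<^bold>\<not> \<phi>" "\<phi> \<^bold>\<rightarrow> \<psi>"]
  by (auto simp: mcs_def tautology_def)

lemma mcs_Conj [simp]: "mcs x \<Longrightarrow> \<phi> \<^bold>\<and> \<psi> \<in> x \<longleftrightarrow> \<phi> \<in> x \<and> \<psi> \<in> x"
  using mcs_taut[of x "\<phi> \<^bold>\<and> \<psi> \<^bold>\<rightarrow> \<phi>"] mcs_taut[of x "\<phi> \<^bold>\<and> \<psi> \<^bold>\<rightarrow> \<psi>"]
    mcs_taut[of x "\<phi> \<^bold>\<rightarrow> \<psi> \<^bold>\<rightarrow> \<phi> \<^bold>\<and> \<psi>"]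
  by (simp add: tautology_def) blast

lemma mcs_Disj [simp]: "mcs x \<Longrightarrow> \<phi> \<^bold>\<or> \<psi> \<in> x \<longleftrightarrow> \<phi> \<in> x \<or> \<psi> \<in> x"
  using mcs_taut[of x "\<phi> \<^bold>\<rightarrow> \<phi> \<^bold>\<or> \<psi>"] mcs_taut[of x "\<psi> \<^bold>\<rightarrow> \<phi> \<^bold>\<or> \<psi>"]
    mcs_taut[of x "\<^bold>\<not> \<phi> \<^bold>\<rightarrow> \<^bold>\<not> \<psi> \<^bold>\<rightarrow> \<^bold>\<not> (\<phi> \<^bold>\<or> \<psi>)"]
  by (simp add: tautology_def) blast

section \<open>The canonical relations\<close>

definition R :: "nat \<Rightarrow> fm set \<Rightarrow> fm set \<Rightarrow> bool" where
  "R n x y \<longleftrightarrow> mcs x \<and> mcs y \<and> (\<forall>\<phi>. \<^bold>[n\<^bold>] \<phi> \<in> x \<longrightarrow> \<phi> \<in> y)"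

lemma R_mcs: "R n x y \<Longrightarrow> mcs x" "R n x y \<Longrightarrow> mcs y"
  by (auto simp: R_def)

lemma R_Box: "R n x y \<Longrightarrow> \<^bold>[n\<^bold>] \<phi> \<in> x \<Longrightarrow> \<phi> \<in> y"
  by (auto simp: R_def)

lemma mcs_Box: "mcs x \<Longrightarrow> \<^bold>[n\<^bold>] \<phi> \<in> x \<longleftrightarrow> (\<forall>y. R n x y \<longrightarrow> \<phi> \<in> y)"
proof (intro iffI allI impI)
  assume x: "mcs x" and "\<forall>y. R n x y \<longrightarrow> \<phi> \<in> y"
  moreover have "deductive {\<psi>. \<^bold>[n\<^bold>] \<psi> \<in> x}"
    unfolding deductive_def
  proof (intro conjI allI impI)
    show "L \<subseteq> {\<psi>. \<^bold>[n\<^bold>] \<psi> \<in> x}" using mcs_L[OF x] Nec by auto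
  next
    fix a b assume "a \<^bold>\<rightarrow> b \<in> {\<psi>. \<^bold>[n\<^bold>] \<psi> \<in> x}" "a \<in> {\<psi>. \<^bold>[n\<^bold>] \<psi> \<in> x}"
    moreover have "\<^bold>[n\<^bold>] (a \<^bold>\<rightarrow> b) \<^bold>\<rightarrow> (\<^bold>[n\<^bold>] a \<^bold>\<rightarrow> \<^bold>[n\<^bold>] b) \<in> x"
      using mcs_L[OF x axiom[OF GLP_axioms.K]] .
    ultimately show "b \<in> {\<psi>. \<^bold>[n\<^bold>] \<psi> \<in> x}" using x by auto
  qed
  ultimately show "\<^bold>[n\<^bold>] \<phi> \<in> x"
    using Lindenbaum[of "{\<psi>. \<^bold>[n\<^bold>] \<psi> \<in> x}" \<phi>] by (auto simp: R_def)
qed (auto simp: R_def)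

lemma mcs_Dia: "mcs x \<Longrightarrow> \<^bold>\<langle>n\<^bold>\<rangle> \<phi> \<in> x \<longleftrightarrow> (\<exists>y. R n x y \<and> \<phi> \<in> y)"
  using mcs_Box[of x n "\<^bold>\<not> \<phi>"] mcs_Neg R_mcs(2) by blast

text \<open>Loeb's axiom as an induction rule along \<open>R n\<close> for a single formula; it
  stands in for converse well-foundedness.\<close>

lemma Loeb_Box:
  assumes x: "mcs x" and "\<And>y. R n x y \<Longrightarrow> \<^bold>[n\<^bold>] \<phi> \<in> y \<Longrightarrow> \<phi> \<in> y"
  shows "\<^bold>[n\<^bold>] \<phi> \<in> x"
proof -
  have "\<^bold>[n\<^bold>] (\<^bold>[n\<^bold>] \<phi> \<^bold>\<rightarrow> \<phi>) \<in> x"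
    unfolding mcs_Box[OF x] using assms(2) mcs_Imp R_mcs(2) by blast
  moreover have "\<^bold>[n\<^bold>] (\<^bold>[n\<^bold>] \<phi> \<^bold>\<rightarrow> \<phi>) \<^bold>\<rightarrow> \<^bold>[n\<^bold>] \<phi> \<in> x"
    using mcs_L[OF x axiom[OF GLP_axioms.Loeb]] .
  ultimately show ?thesis using x by auto
qed

lemma R_Box4:
  assumes "R n x y" "\<^bold>[n\<^bold>] \<phi> \<in> x"
  shows "\<^bold>[n\<^bold>] \<phi> \<in> y"
proof -
  have x: "mcs x" using assms R_mcs by blast
  \<comment> \<open>Loeb induction for \<open>\<phi>\<close> together with its own box: the usual
    derivation of transitivity from Loeb's axiom.\<close>
  have "\<^bold>[n\<^bold>] (\<phi> \<^bold>\<and> \<^bold>[n\<^bold>] \<phi>) \<in> x"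
  proof (rule Loeb_Box[OF x])
    fix z assume z: "R n x z" "\<^bold>[n\<^bold>] (\<phi> \<^bold>\<and> \<^bold>[n\<^bold>] \<phi>) \<in> z"
    then have "\<^bold>[n\<^bold>] \<phi> \<in> z" using mcs_Box[OF R_mcs(2)[OF z(1)]] mcs_Conj R_mcs(2) by blast
    then show "\<phi> \<^bold>\<and> \<^bold>[n\<^bold>] \<phi> \<in> z" using mcs_Conj[OF R_mcs(2)[OF z(1)]] R_Box[OF z(1) assms(2)] by blast
  qed
  then show ?thesis using R_Box[OF assms(1)] R_mcs(2)[OF assms(1)] mcs_Conj by blast
qed

lemma R_trans: "R n x y \<Longrightarrow> R n y z \<Longrightarrow> R n x z"
  unfolding R_def[of n x z] using R_Box[of n y z] R_Box4[of n x y] R_mcs(1)[of n x y] R_mcs(2)[of n y z]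
  by blast

lemma R_antimono_Suc: "R (Suc n) x y \<Longrightarrow> R n x y"
proof -
  assume xy: "R (Suc n) x y"
  have "\<^bold>[n\<^bold>] \<phi> \<^bold>\<rightarrow> \<^bold>[n + 1\<^bold>] \<phi> \<in> x" for \<phi>
    using mcs_L[OF R_mcs(1)[OF xy] axiom[OF GLP_axioms.Mono]] .
  then have "\<^bold>[Suc n\<^bold>] \<phi> \<in> x" if "\<^bold>[n\<^bold>] \<phi> \<in> x" for \<phi>
    using mcs_Imp[OF R_mcs(1)[OF xy]] that by simp
  then show "R n x y" using xy unfolding R_def by blast
qed

lemma R_antimono: "n \<le> k \<Longrightarrow> R k x y \<Longrightarrow> R n x y"
  by (induction k rule: dec_induct) (auto dest: R_antimono_Suc)

text \<open>From \<open>x\<close> to \<open>y\<close> this is transitivity after lowering the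
  modality; from \<open>y\<close> to \<open>x\<close> it is the axiom \<open>Dia_Box\<close> applied
  to the negation.\<close>

lemma R_Box_iff:
  assumes "n < k" "R k x y"
  shows "\<^bold>[n\<^bold>] \<phi> \<in> x \<longleftrightarrow> \<^bold>[n\<^bold>] \<phi> \<in> y"
proof
  have xy: "R (Suc n) x y" using assms R_antimono[of "Suc n" k] by auto
  assume "\<^bold>[n\<^bold>] \<phi> \<in> x" then show "\<^bold>[n\<^bold>] \<phi> \<in> y" using R_Box4 R_antimono_Suc[OF xy] by blast
next
  have xy: "R (Suc n) x y" using assms R_antimono[of "Suc n" k] by auto
  have x: "mcs x" "mcs y" using xy R_mcs by auto
  assume y: "\<^bold>[n\<^bold>] \<phi> \<in> y"
  show "\<^bold>[n\<^bold>] \<phi> \<in> x"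
  proof (rule ccontr)
    assume "\<^bold>[n\<^bold>] \<phi> \<notin> x"
    then have "\<^bold>\<langle>n\<^bold>\<rangle> \<^bold>\<not> \<phi> \<in> x" using mcs_Dia[OF x(1)] mcs_Box[OF x(1)] mcs_Neg R_mcs(2) by blast
    then have "\<^bold>[n + 1\<^bold>] \<^bold>\<langle>n\<^bold>\<rangle> \<^bold>\<not> \<phi> \<in> x"
      using mcs_L[OF x(1) axiom[OF GLP_axioms.Dia_Box], of n "\<^bold>\<not> \<phi>"] x by auto
    then have "\<^bold>\<langle>n\<^bold>\<rangle> \<^bold>\<not> \<phi> \<in> y" using R_Box[OF xy] by simp
    then obtain z where "R n y z" "\<^bold>\<not> \<phi> \<in> z" using mcs_Dia[OF x(2)] by blast
    then show False using R_Box[OF _ y] mcs_Neg R_mcs(2) by blast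
  qed
qed

lemma R_succ_iff: "n < k \<Longrightarrow> R k x y \<Longrightarrow> R n x z \<longleftrightarrow> R n y z"
  unfolding R_def[of n] using R_Box_iff[of n k x y] R_mcs[of k x y] by simp

text \<open>Loeb induction for the negated formula. It provides the least points on which the
  comparison of worms and the Solovay construction rest.\<close>

lemma Loeb_Dia:
  assumes "R n x y" "\<phi> \<in> y"
  shows "\<exists>z. R n x z \<and> \<phi> \<in> z \<and> (\<forall>w. R n z w \<longrightarrow> \<phi> \<notin> w)"
proof (rule ccontr)
  assume "\<not> ?thesis"
  then have a: "\<And>z. R n x z \<Longrightarrow> \<phi> \<in> z \<Longrightarrow> \<exists>w. R n z w \<and> \<phi> \<in> w" by blast
  have x: "mcs x" using assms R_mcs by blast
  have "\<^bold>[n\<^bold>] \<^bold>\<not> \<phi> \<in> x"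
    by (rule Loeb_Box[OF x]) (metis a R_Box R_mcs(2) mcs_Neg)
  then show False using assms R_Box R_mcs mcs_Neg by blast
qed

end

section \<open>Non-degeneracy of GLP\<close>

definition wo :: "nat set rel" where
  "wo = (SOME r. Well_order r \<and> Field r = UNIV)"

lemma wo: "Well_order wo" "Field wo = UNIV"
  using someI_ex[OF well_ordering, where ?'a1 = "nat set"] by (auto simp: wo_def)

text \<open>Since \<open>nat set\<close> is uncountable, the elements with countably many
  predecessors in a well-ordering of it form an ordinal of type omega_1.\<close>

typedef omega1 = "{A. countable (underS wo A)}"
proof -
  have "wf (wo - Id)" using wo by (simp add: well_order_on_def)
  then obtain A :: "nat set" where "\<forall>B. (B, A) \<in> wo - Id \<longrightarrow> B \<notin> UNIV"
    by (metis UNIV_I wf_eq_minimal)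
  then have "underS wo A = {}" by (auto simp: underS_def)
  then show ?thesis by (metis countable_empty mem_Collect_eq)
qed

instantiation omega1 :: wellorder
begin

definition less_eq_omega1 :: "omega1 \<Rightarrow> omega1 \<Rightarrow> bool" where
  "a \<le> b \<longleftrightarrow> (Rep_omega1 a, Rep_omega1 b) \<in> wo"

definition less_omega1 :: "omega1 \<Rightarrow> omega1 \<Rightarrow> bool" where
  "a < b \<longleftrightarrow> a \<le> b \<and> a \<noteq> (b :: omega1)"

instance
proof
  have lin: "linear_order_on UNIV wo" and w: "wf (wo - Id)" using wo by (auto simp: well_order_on_def)
  then have refl: "refl wo" and trans: "trans wo" and antisym: "antisym wo" and total: "total wo"
    by (auto simp: linear_order_on_def partial_order_on_def preorder_on_def)
  fix a b c :: omega1
  show "a \<le> a" using refl by (simp add: less_eq_omega1_def refl_on_def)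
  show anti: "a = b" if "a \<le> b" "b \<le> a" for a b :: omega1
    using antisym that unfolding less_eq_omega1_def antisym_def by (metis Rep_omega1_inject)
  show "a < b \<longleftrightarrow> a \<le> b \<and> \<not> b \<le> a" using anti \<open>a \<le> a\<close> by (auto simp: less_omega1_def)
  show "a \<le> b \<Longrightarrow> b \<le> c \<Longrightarrow> a \<le> c" using trans unfolding less_eq_omega1_def by (rule transD)
  show "a \<le> b \<or> b \<le> a"
    using total refl by (metis less_eq_omega1_def refl_on_def total_on_def UNIV_I)
  fix P :: "omega1 \<Rightarrow> bool"
  assume step: "\<And>x. (\<And>y. y < x \<Longrightarrow> P y) \<Longrightarrow> P x"
  have "wf {(x, y). x < (y :: omega1)}"
    by (rule wf_subset[OF wf_inv_image[OF w, of Rep_omega1]])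
      (auto simp: less_omega1_def less_eq_omega1_def Rep_omega1_inject)
  then show "P a" using step by (induction a rule: wf_induct_rule) auto
qed

end

lemma countable_lessThan_omega1: "countable {..<a :: omega1}"
proof -
  have "Rep_omega1 ` {..<a} \<subseteq> underS wo (Rep_omega1 a)"
    by (auto simp: underS_def less_omega1_def less_eq_omega1_def Rep_omega1_inject)
  moreover have "countable (underS wo (Rep_omega1 a))" using Rep_omega1 by simp
  ultimately have "countable (Rep_omega1 ` {..<a})" by (rule countable_subset)
  then show ?thesis by (rule countable_image_inj_on) (simp add: inj_on_def Rep_omega1_inject)
qed

lemma uncountable_omega1: "uncountable (UNIV :: omega1 set)"
proof
  assume "countable (UNIV :: omega1 set)"
  then have c: "countable (range Rep_omega1)" by simp
  have range: "range Rep_omega1 = {A. countable (underS wo A)}"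
    using type_definition.Rep_range[OF type_definition_omega1] .
  have "uncountable (UNIV :: nat set set)"
  proof
    assume "countable (UNIV :: nat set set)"
    then obtain f :: "nat \<Rightarrow> nat set" where "range f = UNIV"
      by (metis UNIV_not_empty range_from_nat_into)
    then show False using Cantors_theorem[of UNIV] by auto
  qed
  \<comment> \<open>The least element of the complement has all its predecessors in the countable
    range, so it would belong to the range itself.\<close>
  then have "- range Rep_omega1 \<noteq> {}" using c by (metis double_compl compl_bot_eq)
  moreover have "wf (wo - Id)" using wo by (simp add: well_order_on_def)
  ultimately obtain A where A: "A \<in> - range Rep_omega1"
    and min: "\<And>B. (B, A) \<in> wo - Id \<Longrightarrow> B \<in> range Rep_omega1"
    by (metis ComplD ComplI ex_in_conv wf_eq_minimal)
  have "underS wo A \<subseteq> range Rep_omega1" using min by (auto simp: underS_def)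
  then have "countable (underS wo A)" using c by (rule countable_subset)
  then have "A \<in> range Rep_omega1" unfolding range by blast
  then show False using A by blast
qed

lemma omega1_bound:
  assumes "countable (A :: omega1 set)"
  shows "\<exists>b. \<forall>a\<in>A. a < b"
proof (rule ccontr)
  assume "\<not> ?thesis"
  then have "UNIV = (\<Union>a\<in>A. {..<a} \<union> {a})" by (auto simp: not_less le_less)
  moreover have "countable (\<Union>a\<in>A. {..<a} \<union> {a})"
    using assms countable_lessThan_omega1 by auto
  ultimately show False using uncountable_omega1 by simp
qed

text \<open>The limes superior of \<open>lim_rank b + 1\<close> for \<open>b\<close> tending to \<open>a\<close> from below; it takes the
  place of the last exponent of the Cantor normal form in Ignatiev's model.\<close>

function lim_rank :: "omega1 \<Rightarrow> omega1" where
  "lim_rank a = (LEAST d. (\<forall>b\<in>{..<a}. lim_rank b < d) \<or> (\<exists>c<a. \<forall>b\<in>{c<..<a}. lim_rank b < d))"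
  by pat_completeness auto
termination
  by (relation "{(x, y). x < y}") (auto simp: wellorder_class.wf)

declare lim_rank.simps [simp del]

section \<open>Values of the rank function\<close>

lemma lim_rank_below:
  assumes "d < lim_rank a"
  shows "\<exists>b<a. d \<le> lim_rank b" and "c < a \<Longrightarrow> \<exists>b>c. b < a \<and> d \<le> lim_rank b"
  using not_less_Least[OF assms[unfolded lim_rank.simps[of a]]]
  by (auto simp: not_less) (metis greaterThanLessThan_iff not_le)

lemma le_lim_rank:
  assumes "\<And>c d'. c < a \<Longrightarrow> d' < d \<Longrightarrow> \<exists>b>c. b < a \<and> d' \<le> lim_rank b" and "c0 < a"
  shows "d \<le> lim_rank a"
proof (rule ccontr)
  let ?C = "\<lambda>d. (\<forall>b\<in>{..<a}. lim_rank b < d) \<or> (\<exists>c<a. \<forall>b\<in>{c<..<a}. lim_rank b < d)"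
  assume "\<not> ?thesis"
  then have less: "lim_rank a < d" by simp
  \<comment> \<open>A strict bound on all earlier ranks shows that the least element defining
    \<open>lim_rank\<close> is taken over a nonempty set.\<close>
  obtain e where "\<forall>b\<in>{..<a}. lim_rank b < e"
    using omega1_bound[of "lim_rank ` {..<a}"] countable_lessThan_omega1 by auto
  then have "?C e" by blast
  then have "?C (lim_rank a)" unfolding lim_rank.simps[of a] by (rule LeastI)
  then show False using assms(1)[OF _ less] assms(2) by (metis greaterThanLessThan_iff lessThan_iff not_less)
qed

text \<open>By induction every smaller rank is attained or exceeded above every ordinal. There are
  only countably many smaller ranks, so one can move past a choice for each of them; omega such
  rounds lead to a supremum near which all of them recur.\<close>

lemma lim_rank_cofinal: "\<exists>a>c. d \<le> lim_rank a"
proof (induction d arbitrary: c rule: less_induct)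
  case (less d)
  then obtain pick where pick: "\<And>d' c. d' < d \<Longrightarrow> c < pick d' c \<and> d' \<le> lim_rank (pick d' c)"
    by metis
  have "\<exists>s. c < s \<and> (\<forall>d'<d. pick d' c < s)" for c
    using omega1_bound[of "insert c ((\<lambda>d'. pick d' c) ` {..<d})"] countable_lessThan_omega1[of d] by auto
  then obtain s where s: "\<And>c. c < s c" "\<And>c d'. d' < d \<Longrightarrow> pick d' c < s c" by metis
  define g where "g i = (s ^^ i) c" for i
  have g: "g i < g (Suc i)" for i using s by (simp add: g_def)
  \<comment> \<open>As \<open>g\<close> is strictly increasing, its least strict upper bound is its
    supremum.\<close>
  define a where "a = (LEAST a. \<forall>i. g i < a)"
  have "\<exists>b. \<forall>i. g i < b" using omega1_bound[of "range g"] by auto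
  then have "\<forall>i. g i < a" unfolding a_def by (rule LeastI_ex)
  then have ga: "g i < a" for i ..
  have "d \<le> lim_rank a"
  proof (rule le_lim_rank[OF _ ga])
    fix c' d' assume "c' < a" "d' < d"
    then obtain i where "c' \<le> g i" using not_less_Least[of c' "\<lambda>a. \<forall>i. g i < a"] by (auto simp: a_def not_less)
    moreover have "pick d' (g i) < a"
      using s(2)[OF \<open>d' < d\<close>, of "g i"] ga[of "Suc i"] by (simp add: g_def)
    ultimately show "\<exists>b>c'. b < a \<and> d' \<le> lim_rank b" using pick[OF \<open>d' < d\<close>, of "g i"] by force
  qed
  moreover have "c < a" using ga[of 0] by (simp add: g_def)
  ultimately show ?case by blast
qed

section \<open>Ignatiev's model over the countable ordinals\<close>

definition point :: "(nat \<Rightarrow> omega1) \<Rightarrow> bool" where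
  "point x \<longleftrightarrow> (\<forall>k. x (Suc k) \<le> lim_rank (x k))"

definition point_rel :: "nat \<Rightarrow> (nat \<Rightarrow> omega1) \<Rightarrow> (nat \<Rightarrow> omega1) \<Rightarrow> bool" where
  "point_rel n x y \<longleftrightarrow> point y \<and> (\<forall>k<n. y k = x k) \<and> y n < x n"

lemma point_rel_trans: "point_rel n x y \<Longrightarrow> point_rel n y z \<Longrightarrow> point_rel n x z"
  by (auto simp: point_rel_def)

text \<open>The valuation is fixed because the frame does not validate \<open>Mono\<close>: an
  (n+1)-successor keeps coordinate \<open>n\<close>, while an n-successor lowers it. The axiom holds
  only for sets of points definable in a controlled way.\<close>

primrec point_sat :: "fm \<Rightarrow> (nat \<Rightarrow> omega1) \<Rightarrow> bool" where
  "point_sat (Var p) x \<longleftrightarrow> True"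
| "point_sat \<^bold>\<top> x \<longleftrightarrow> True"
| "point_sat (\<^bold>\<not> \<phi>) x \<longleftrightarrow> \<not> point_sat \<phi> x"
| "point_sat (\<phi> \<^bold>\<and> \<psi>) x \<longleftrightarrow> point_sat \<phi> x \<and> point_sat \<psi> x"
| "point_sat (\<phi> \<^bold>\<or> \<psi>) x \<longleftrightarrow> point_sat \<phi> x \<or> point_sat \<psi> x"
| "point_sat (\<phi> \<^bold>\<rightarrow> \<psi>) x \<longleftrightarrow> (point_sat \<phi> x \<longrightarrow> point_sat \<psi> x)"
| "point_sat (\<^bold>[n\<^bold>] \<phi>) x \<longleftrightarrow> (\<forall>y. point_rel n x y \<longrightarrow> point_sat \<phi> y)"

text \<open>Built from the back: a point with a large coordinate is shifted by one place and
  preceded by an ordinal of sufficiently high rank.\<close>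

lemma exists_point: "\<exists>x. point x \<and> d \<le> x m"
proof (induction m arbitrary: d)
  case 0
  let ?bot = "LEAST a :: omega1. True"
  have "point (case_nat d (\<lambda>_. ?bot))"
    by (auto simp: point_def Least_le split: nat.split)
  then show ?case by force
next
  case (Suc m)
  then obtain y where y: "point y" "d \<le> y m" by blast
  obtain a where "y 0 \<le> lim_rank a" using lim_rank_cofinal by blast
  then have "point (case_nat a y)" using y by (auto simp: point_def split: nat.split)
  then show ?case using y by force
qed

definition splice :: "nat \<Rightarrow> (nat \<Rightarrow> omega1) \<Rightarrow> (nat \<Rightarrow> omega1) \<Rightarrow> nat \<Rightarrow> omega1" where
  "splice n x z k = (if k < n then x k else z k)"

text \<open>The only junction in doubt is that of coordinates \<open>n - 1\<close> and
  \<open>n\<close>, and the assumption on coordinate \<open>n\<close> secures it. This is how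
  n-successors with a prescribed tail are made.\<close>

lemma point_splice:
  assumes "point x" "point z" "z n \<le> x n"
  shows "point (splice n x z)"
  unfolding point_def
proof
  fix k
  consider "Suc k < n" | "Suc k = n" | "n \<le> k" by linarith
  then show "splice n x z (Suc k) \<le> lim_rank (splice n x z k)"
  proof cases
    case 2
    then have "z (Suc k) \<le> x (Suc k)" using assms(3) by simp
    also have "\<dots> \<le> lim_rank (x k)" using assms(1) by (simp add: point_def)
    finally show ?thesis using 2 by (auto simp: splice_def)
  qed (use assms in \<open>auto simp: splice_def point_def\<close>)
qed

text \<open>The truth value of a formula depends only on the position of finitely many coordinates
  relative to finitely many ordinals. This is what makes the monotonicity axiom sound.\<close>

definition same_pattern :: "nat \<Rightarrow> omega1 set \<Rightarrow> (nat \<Rightarrow> omega1) \<Rightarrow> (nat \<Rightarrow> omega1) \<Rightarrow> bool" where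
  "same_pattern K F x y \<longleftrightarrow> (\<forall>k<K. \<forall>a\<in>F. a < x k \<longleftrightarrow> a < y k)"

definition supported :: "nat \<Rightarrow> omega1 set \<Rightarrow> ((nat \<Rightarrow> omega1) \<Rightarrow> bool) \<Rightarrow> bool" where
  "supported K F P \<longleftrightarrow> finite F \<and>
    (\<forall>x y. point x \<longrightarrow> point y \<longrightarrow> same_pattern K F x y \<longrightarrow> P x \<longrightarrow> P y)"

section \<open>Truth depends on finite patterns only\<close>

lemma same_pattern_sym: "same_pattern K F x y \<Longrightarrow> same_pattern K F y x"
  by (auto simp: same_pattern_def)

lemma same_pattern_mono:
  "same_pattern K F x y \<Longrightarrow> K' \<le> K \<Longrightarrow> F' \<subseteq> F \<Longrightarrow> same_pattern K' F' x y"
  by (auto simp: same_pattern_def subset_eq)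

lemma supported_iff:
  "supported K F P \<Longrightarrow> point x \<Longrightarrow> point y \<Longrightarrow> same_pattern K F x y \<Longrightarrow> P x \<longleftrightarrow> P y"
  using same_pattern_sym unfolding supported_def by blast

text \<open>Among all points with a given pattern \<open>c\<close>, let \<open>\<xi> c\<close> be
  the least n-th coordinate. Whether the pattern can be realised strictly below \<open>x n\<close>
  depends only on whether \<open>\<xi> c < x n\<close>. There are finitely many patterns, so adding
  these thresholds to \<open>F\<close> keeps the support finite.\<close>

lemma supported_Box:
  assumes P: "supported K F P"
  shows "\<exists>K F. supported K F (\<lambda>x. \<forall>y. point_rel n x y \<longrightarrow> P y)"
proof -
  define pat where "pat z = {(k, a). k < K \<and> a \<in> F \<and> a < z k}" for z :: "nat \<Rightarrow> omega1"
  define \<xi> where "\<xi> c = (LEAST a. \<exists>z. point z \<and> pat z = c \<and> z n = a)" for c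
  define F' where "F' = F \<union> \<xi> ` Pow ({..<K} \<times> F)"
  \<comment> \<open>Coordinate \<open>n\<close> itself has to be compared with the new thresholds,
    hence \<open>Suc n\<close>.\<close>
  define K' where "K' = max K (Suc n)"
  have F: "finite F" using P by (simp add: supported_def)
  have pat: "same_pattern K F x y \<longleftrightarrow> pat x = pat y" for x y
    by (auto simp: same_pattern_def pat_def set_eq_iff)
  have "\<exists>y'. point_rel n x' y' \<and> \<not> P y'"
    if x: "point x" "point x'" "same_pattern K' F' x x'" and y: "point_rel n x y" "\<not> P y" for x x' y
  proof -
    have py: "point y" "\<And>k. k < n \<Longrightarrow> y k = x k" "y n < x n" using y by (auto simp: point_rel_def)
    obtain z where z: "point z" "pat z = pat y" "z n = \<xi> (pat y)"
      using LeastI[of "\<lambda>a. \<exists>z. point z \<and> pat z = pat y \<and> z n = a" "y n"] py(1) unfolding \<xi>_def by blast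
    have "\<xi> (pat y) \<le> y n"
      unfolding \<xi>_def by (rule Least_le) (use py in blast)
    moreover have "\<xi> (pat y) \<in> F'" unfolding F'_def pat_def by (rule UnI2, rule imageI) auto
    ultimately have zn: "z n < x' n"
      using x(3) py(3) z(3) unfolding same_pattern_def K'_def by (metis le_less_trans lessI max.strict_coboundedI2)
    \<comment> \<open>Below \<open>n\<close> the prefix of \<open>x'\<close> shows the same pattern
      as that of \<open>x\<close>, which \<open>y\<close> shares; from \<open>n\<close> on the
      cheapest realisation \<open>z\<close> of the pattern of \<open>y\<close> is used.\<close>
    let ?y = "splice n x' z"
    have p: "point ?y" using point_splice x(2) z(1) zn by simp
    have "same_pattern K F x x'" using x(3) by (rule same_pattern_mono) (auto simp: K'_def F'_def)
    then have "same_pattern K F y ?y"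
      using z(2)[folded pat] py(2) by (auto simp: same_pattern_def splice_def)
    then have "\<not> P ?y" using supported_iff[OF P py(1) p] y(2) by blast
    then show ?thesis using p zn by (auto simp: point_rel_def splice_def)
  qed
  then have "supported K' F' (\<lambda>x. \<forall>y. point_rel n x y \<longrightarrow> P y)"
    unfolding supported_def using F same_pattern_sym by (auto simp: F'_def) blast
  then show ?thesis by blast
qed

lemma supported_mono: "supported K F P \<Longrightarrow> K \<le> K' \<Longrightarrow> F \<subseteq> F' \<Longrightarrow> finite F' \<Longrightarrow> supported K' F' P"
  unfolding supported_def using same_pattern_mono by blast

lemma supported_point_sat: "\<exists>K F. supported K F (point_sat \<phi>)"
proof -
  have binary: "\<exists>K F. supported K F (\<lambda>x. f (P x) (Q x))"
    if PQ: "\<exists>K F. supported K F P" "\<exists>K F. supported K F Q"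
    for f :: "bool \<Rightarrow> bool \<Rightarrow> bool" and P Q
  proof -
    obtain K F K' F' where P: "supported K F P" and Q: "supported K' F' Q" using PQ by blast
    have fin: "finite F" "finite F'" using P Q by (auto simp: supported_def)
    have "supported (max K K') (F \<union> F') P" "supported (max K K') (F \<union> F') Q"
      using P Q fin by (auto elim: supported_mono)
    then have "supported (max K K') (F \<union> F') (\<lambda>x. f (P x) (Q x))"
      using supported_iff[of "max K K'" "F \<union> F'" P] supported_iff[of "max K K'" "F \<union> F'" Q] fin
      by (simp add: supported_def[of _ _ "\<lambda>x. f (P x) (Q x)"])
    then show ?thesis by blast
  qed
  have const: "\<exists>K F. supported K F (\<lambda>x. True)" by (auto simp: supported_def)
  show ?thesis
  proof (induction \<phi>)
    case (Neg \<phi>)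
    then show ?case using binary[of "point_sat \<phi>" "point_sat \<phi>" "\<lambda>a b. \<not> a"] by simp
  next
    case (Conj \<phi> \<psi>)
    then show ?case using binary[of "point_sat \<phi>" "point_sat \<psi>" "(\<and>)"] by simp
  next
    case (Disj \<phi> \<psi>)
    then show ?case using binary[of "point_sat \<phi>" "point_sat \<psi>" "(\<or>)"] by simp
  next
    case (Imp \<phi> \<psi>)
    then show ?case using binary[of "point_sat \<phi>" "point_sat \<psi>" "(\<longrightarrow>)"] by simp
  next
    case (Box n \<phi>)
    then show ?case using supported_Box by fastforce
  qed (use const in simp_all)
qed

text \<open>Let \<open>y\<close> be an (n+1)-successor refuting \<open>\<phi>\<close>. Since
  \<open>y (Suc n)\<close> is below the rank of \<open>x n\<close>, ordinals \<open>b\<close> of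
  rank at least \<open>y (Suc n)\<close> occur arbitrarily close below \<open>x n\<close>. Choosing
  \<open>b\<close> above all thresholds smaller than \<open>x n\<close> and replacing coordinate
  \<open>n\<close> by \<open>b\<close> preserves the pattern, so the result still refutes
  \<open>\<phi>\<close>, but is now an n-successor.\<close>

lemma point_sat_Mono:
  assumes x: "point x" and box: "point_sat (\<^bold>[n\<^bold>] \<phi>) x"
  shows "point_sat (\<^bold>[Suc n\<^bold>] \<phi>) x"
proof (rule ccontr)
  assume "\<not> ?thesis"
  then obtain y where y: "point_rel (Suc n) x y" "\<not> point_sat \<phi> y" by auto
  then have py: "point y" "\<And>k. k \<le> n \<Longrightarrow> y k = x k" "y (Suc n) < x (Suc n)"
    by (auto simp: point_rel_def)
  obtain K F where F: "supported K F (point_sat \<phi>)" using supported_point_sat by blast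
  then have "finite F" by (simp add: supported_def)
  have less: "y (Suc n) < lim_rank (x n)" using py(3) x by (auto simp: point_def intro: less_le_trans)
  obtain b where b: "b < x n" "y (Suc n) \<le> lim_rank b" and above: "\<And>a. a \<in> F \<Longrightarrow> a < x n \<Longrightarrow> a < b"
  proof (cases "{a \<in> F. a < x n} = {}")
    case True
    then show ?thesis using lim_rank_below(1)[OF less] that by blast
  next
    case False
    let ?c = "Max {a \<in> F. a < x n}"
    have "?c \<in> {a \<in> F. a < x n}" using False \<open>finite F\<close> by (intro Max_in) auto
    then obtain b where "b > ?c" "b < x n" "y (Suc n) \<le> lim_rank b"
      using lim_rank_below(2)[OF less, of ?c] by blast
    moreover have "a \<le> ?c" if "a \<in> F" "a < x n" for a
      using that \<open>finite F\<close> by (intro Max_ge) auto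
    ultimately show ?thesis using that by (meson le_less_trans)
  qed
  define z where "z = y(n := b)"
  have z: "point z"
    unfolding point_def
  proof
    fix k
    consider "k = n" | "Suc k = n" | "k \<noteq> n" "Suc k \<noteq> n" by blast
    then show "z (Suc k) \<le> lim_rank (z k)"
    proof cases
      \<comment> \<open>Lowering coordinate \<open>n\<close> cannot break the bound that coordinate
        \<open>n - 1\<close> imposes on it.\<close>
      case 2
      have "b \<le> x (Suc k)" using 2 b by simp
      also have "\<dots> \<le> lim_rank (y k)" using x[unfolded point_def, rule_format, of k] py(2)[of k] 2 by simp
      finally show ?thesis using 2 by (simp add: z_def)
    qed (use b py(1) in \<open>auto simp: z_def point_def\<close>)
  qed
  have "same_pattern K F y z"
    using above b(1) py(2)[of n] by (auto simp: same_pattern_def z_def)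
  then have "\<not> point_sat \<phi> z" using supported_iff[OF F py(1) z] y by blast
  moreover have "point_rel n x z" using z b(1) py(2) by (auto simp: point_rel_def z_def)
  ultimately show False using box by auto
qed

section \<open>Soundness of the model\<close>

lemma point_sat_GLP: "\<phi> \<in> GLP \<Longrightarrow> point x \<Longrightarrow> point_sat \<phi> x"
  unfolding GLP_def
proof (induction arbitrary: x rule: theorems_of.induct)
  case (Ax \<phi>)
  from Ax(1) show ?case
  proof cases
    case Taut
    have "prop_eval (\<lambda>\<psi>. point_sat \<psi> x) \<psi> \<longleftrightarrow> point_sat \<psi> x" for \<psi> by (induction \<psi>) auto
    then show ?thesis using Taut by (auto simp: tautology_def)
  next
    case (Loeb n \<psi>)
    have "point_sat \<psi> y" if H: "point_sat (\<^bold>[n\<^bold>] (\<^bold>[n\<^bold>] \<psi> \<^bold>\<rightarrow> \<psi>)) x" and "point_rel n x y" for y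
      using that(2)
    proof (induction "y n" arbitrary: y rule: less_induct)
      case less
      have "point_sat \<psi> z" if "point_rel n y z" for z
        using less.hyps[of z] point_rel_trans[OF less.prems that] that by (simp add: point_rel_def)
      then show ?case using H less.prems by simp
    qed
    then show ?thesis unfolding Loeb(1) point_sat.simps(6) point_sat.simps(7)[of n \<psi>] by blast
  next
    case (Mono n \<psi>)
    then show ?thesis using point_sat_Mono Ax(2) by auto
  next
    case (Dia_Box n \<psi>)
    then show ?thesis by (auto simp: point_rel_def)
  qed auto
next
  case (Nec \<phi> n)
  then show ?case by (auto simp: point_rel_def)
qed auto

lemma Box_Falsum_notin_GLP: "\<^bold>[n\<^bold>] \<^bold>\<bottom> \<notin> GLP"
proof
  assume a: "\<^bold>[n\<^bold>] \<^bold>\<bottom> \<in> GLP"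
  obtain c :: omega1 where True by blast
  obtain d where "d > c" using lim_rank_cofinal by blast
  obtain x where x: "point x" "d \<le> x n" using exists_point by blast
  have less: "(LEAST a. True) < x n"
    using le_less_trans[OF Least_le[of "\<lambda>_. True" c]] x(2) \<open>d > c\<close> by (meson TrueI less_le_trans)
  \<comment> \<open>\<open>LEAST a. True\<close> is the ordinal zero: the tail from \<open>n\<close>
    on is erased, which lowers the nonzero coordinate \<open>n\<close>.\<close>
  let ?z = "\<lambda>k. if k < n then x k else LEAST a. True"
  have "point_rel n x ?z"
    using point_splice[OF x(1), of "\<lambda>_. LEAST a. True" n] x less
    by (auto simp: point_rel_def splice_def[abs_def] point_def Least_le)
  then show False using point_sat_GLP[OF a x(1)] by auto
qed

section \<open>Worms and the closed fragment\<close>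

primrec modalities :: "fm \<Rightarrow> nat set" where
  "modalities (Var p) = {}"
| "modalities \<^bold>\<top> = {}"
| "modalities (\<^bold>\<not> \<phi>) = modalities \<phi>"
| "modalities (\<phi> \<^bold>\<and> \<psi>) = modalities \<phi> \<union> modalities \<psi>"
| "modalities (\<phi> \<^bold>\<or> \<psi>) = modalities \<phi> \<union> modalities \<psi>"
| "modalities (\<phi> \<^bold>\<rightarrow> \<psi>) = modalities \<phi> \<union> modalities \<psi>"
| "modalities (\<^bold>[n\<^bold>] \<phi>) = insert n (modalities \<phi>)"

lemma finite_modalities: "finite (modalities \<phi>)"
  by (induction \<phi>) auto

definition worm :: "nat list \<Rightarrow> fm" where
  "worm ks = foldr (\<lambda>k \<phi>. \<^bold>\<langle>k\<^bold>\<rangle> \<phi>) ks \<^bold>\<top>"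

lemma worm_simps [simp]: "worm [] = \<^bold>\<top>" "worm (k # ks) = \<^bold>\<langle>k\<^bold>\<rangle> worm ks"
  by (simp_all add: worm_def)

definition minimal :: "nat \<Rightarrow> fm \<Rightarrow> fm" where
  "minimal n \<phi> = \<phi> \<^bold>\<and> \<^bold>[n\<^bold>] \<^bold>\<not> \<phi>"

context glp_logic
begin

text \<open>By \<open>L_iff_mcs\<close> this is provable implication, in a form that can be checked
  at one world at a time.\<close>

definition entails :: "fm \<Rightarrow> fm \<Rightarrow> bool" where
  "entails \<phi> \<psi> \<longleftrightarrow> (\<forall>x. mcs x \<longrightarrow> \<phi> \<in> x \<longrightarrow> \<psi> \<in> x)"

definition equiv :: "fm \<Rightarrow> fm \<Rightarrow> bool" where
  "equiv \<phi> \<psi> \<longleftrightarrow> (\<forall>x. mcs x \<longrightarrow> (\<phi> \<in> x \<longleftrightarrow> \<psi> \<in> x))"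

lemma entailsD: "entails \<phi> \<psi> \<Longrightarrow> mcs x \<Longrightarrow> \<phi> \<in> x \<Longrightarrow> \<psi> \<in> x"
  by (auto simp: entails_def)

lemma equivD: "equiv \<phi> \<psi> \<Longrightarrow> mcs x \<Longrightarrow> \<phi> \<in> x \<longleftrightarrow> \<psi> \<in> x"
  by (auto simp: equiv_def)

lemma equiv_refl: "equiv \<phi> \<phi>"
  by (simp add: equiv_def)

lemma equiv_sym: "equiv \<phi> \<psi> \<Longrightarrow> equiv \<psi> \<phi>"
  by (simp add: equiv_def)

lemma equiv_trans: "equiv \<phi> \<psi> \<Longrightarrow> equiv \<psi> \<chi> \<Longrightarrow> equiv \<phi> \<chi>"
  by (simp add: equiv_def)

lemma entails_Dia: "entails \<phi> \<psi> \<Longrightarrow> entails (\<^bold>\<langle>n\<^bold>\<rangle> \<phi>) (\<^bold>\<langle>n\<^bold>\<rangle> \<psi>)"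
  unfolding entails_def using mcs_Dia R_mcs(2) by metis

lemma equiv_Dia: "equiv \<phi> \<psi> \<Longrightarrow> equiv (\<^bold>\<langle>n\<^bold>\<rangle> \<phi>) (\<^bold>\<langle>n\<^bold>\<rangle> \<psi>)"
  unfolding equiv_def using mcs_Dia R_mcs(2) by metis

lemma equiv_Box: "equiv \<phi> \<psi> \<Longrightarrow> equiv (\<^bold>[n\<^bold>] \<phi>) (\<^bold>[n\<^bold>] \<psi>)"
  unfolding equiv_def using mcs_Box R_mcs(2) by metis

section \<open>The order of worms\<close>

lemma Dia_mcs_succ: "n < k \<Longrightarrow> R k x y \<Longrightarrow> \<^bold>\<langle>n\<^bold>\<rangle> \<phi> \<in> x \<longleftrightarrow> \<^bold>\<langle>n\<^bold>\<rangle> \<phi> \<in> y"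
  by (simp add: mcs_Neg[OF R_mcs(1)] mcs_Neg[OF R_mcs(2)] R_Box_iff)

lemma Dia_pull:
  assumes "n < k" "mcs x"
  shows "\<^bold>\<langle>k\<^bold>\<rangle> \<phi> \<in> x \<and> \<^bold>\<langle>n\<^bold>\<rangle> \<psi> \<in> x \<longleftrightarrow> \<^bold>\<langle>k\<^bold>\<rangle> (\<phi> \<^bold>\<and> \<^bold>\<langle>n\<^bold>\<rangle> \<psi>) \<in> x"
  unfolding mcs_Dia[OF assms(2), of k]
  using Dia_mcs_succ[OF assms(1)] mcs_Conj R_mcs(2) by blast

lemma Dia_Dia: "mcs x \<Longrightarrow> \<^bold>\<langle>n\<^bold>\<rangle> \<^bold>\<langle>n\<^bold>\<rangle> \<phi> \<in> x \<Longrightarrow> \<^bold>\<langle>n\<^bold>\<rangle> \<phi> \<in> x"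
  using mcs_Dia R_mcs(2) R_trans by metis

text \<open>Repeated \<open>Dia_pull\<close>: the diamond \<open>n\<close> moves out of any block of
  diamonds above \<open>n\<close>.\<close>

lemma worm_append:
  "\<forall>k\<in>set A. n < k \<Longrightarrow> mcs x \<Longrightarrow> worm (A @ n # B) \<in> x \<longleftrightarrow> worm A \<in> x \<and> \<^bold>\<langle>n\<^bold>\<rangle> worm B \<in> x"
proof (induction A arbitrary: x)
  case (Cons k A)
  then have "equiv (worm (A @ n # B)) (worm A \<^bold>\<and> \<^bold>\<langle>n\<^bold>\<rangle> worm B)" by (simp add: equiv_def del: mcs_Neg)
  from equivD[OF equiv_Dia[OF this, of k] Cons.prems(2)] show ?case
    using Dia_pull[of n k x] Cons.prems by (simp del: mcs_Neg)
qed (simp del: mcs_Neg)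

lemma worm_split:
  assumes "\<forall>k\<in>set A. n \<le> k" and x: "mcs x"
  shows "worm A \<in> x \<longleftrightarrow> worm (takeWhile ((<) n) A) \<in> x \<and>
    (dropWhile ((<) n) A \<noteq> [] \<longrightarrow> \<^bold>\<langle>n\<^bold>\<rangle> worm (tl (dropWhile ((<) n) A)) \<in> x)"
proof (cases "dropWhile ((<) n) A")
  case Nil
  then have "takeWhile ((<) n) A = A" by (metis append_Nil2 takeWhile_dropWhile_id)
  then show ?thesis unfolding Nil by metis
next
  case (Cons k B)
  then have "\<not> n < k" by (metis hd_dropWhile list.sel(1) list.simps(3))
  moreover have "k \<in> set A" using Cons by (metis list.set_intros(1) set_dropWhileD)
  ultimately have "k = n" using assms by force
  then have "A = takeWhile ((<) n) A @ n # B" using Cons by (metis takeWhile_dropWhile_id)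
  then have "worm A = worm (takeWhile ((<) n) A @ n # B)" by simp
  moreover have "\<forall>k\<in>set (takeWhile ((<) n) A). n < k" by (auto dest: set_takeWhileD)
  ultimately show ?thesis using worm_append[of "takeWhile ((<) n) A" n x B] Cons x by (simp del: mcs_Neg)
qed

definition comparable :: "nat \<Rightarrow> fm \<Rightarrow> fm \<Rightarrow> bool" where
  "comparable n \<phi> \<psi> \<longleftrightarrow> entails \<phi> (\<^bold>\<langle>n\<^bold>\<rangle> \<psi>) \<or> entails \<psi> (\<^bold>\<langle>n\<^bold>\<rangle> \<phi>) \<or> equiv \<phi> \<psi>"

text \<open>Each worm is cut at its first \<open>n\<close> into a head (\<open>A0\<close>,
  \<open>B0\<close>) with modalities above \<open>n\<close> and a tail (\<open>A1\<close>,
  \<open>B1\<close>). The heads are compared one level up, and each tail is compared with the whole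
  other worm, which is shorter in total; the bound \<open>m\<close> makes the level part of the
  measure decrease. Unless the tails decide at once, each worm entails \<open>n\<close>-possibility
  of the other's tail, and the heads settle the matter.\<close>

lemma worms_comparable:
  assumes "set A \<subseteq> {n..<m}" "set B \<subseteq> {n..<m}"
  shows "comparable n (worm A) (worm B)"
  using assms
proof (induction "length A + length B + (m - n)" arbitrary: A B n rule: less_induct)
  case less
  show ?case
  proof (cases "n < m")
    case False
    then have "A = []" "B = []" using less.prems by auto
    then show ?thesis by (simp add: comparable_def equiv_refl)
  next
    case True
    define A0 A1 B0 B1 where "A0 = takeWhile ((<) n) A" and "A1 = tl (dropWhile ((<) n) A)"
      and "B0 = takeWhile ((<) n) B" and "B1 = tl (dropWhile ((<) n) B)"
    define a b where "a = (dropWhile ((<) n) A \<noteq> [])" and "b = (dropWhile ((<) n) B \<noteq> [])"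
    have A: "worm A \<in> x \<longleftrightarrow> worm A0 \<in> x \<and> (a \<longrightarrow> \<^bold>\<langle>n\<^bold>\<rangle> worm A1 \<in> x)" if "mcs x" for x
      using worm_split[of A n x] less.prems(1) that unfolding A0_def A1_def a_def by force
    have B: "worm B \<in> x \<longleftrightarrow> worm B0 \<in> x \<and> (b \<longrightarrow> \<^bold>\<langle>n\<^bold>\<rangle> worm B1 \<in> x)" if "mcs x" for x
      using worm_split[of B n x] less.prems(2) that unfolding B0_def B1_def b_def by force
    have len: "length A0 \<le> length A" "length B0 \<le> length B"
      by (simp_all add: A0_def B0_def length_takeWhile_le)
    have len1: "length A1 < length A" if a
      using that length_dropWhile_le[of "(<) n" A] unfolding a_def A1_def
      by (cases "dropWhile ((<) n) A") auto
    have len2: "length B1 < length B" if b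
      using that length_dropWhile_le[of "(<) n" B] unfolding b_def B1_def
      by (cases "dropWhile ((<) n) B") auto
    have set0: "set A0 \<subseteq> {Suc n..<m}" "set B0 \<subseteq> {Suc n..<m}"
      using less.prems unfolding A0_def B0_def by (fastforce dest: set_takeWhileD)+
    have tl: "set (tl (dropWhile P xs)) \<subseteq> set xs" for P and xs :: "nat list"
      by (metis list.sel(2) list.set_sel(2) set_dropWhileD subsetI)
    have set1: "set A1 \<subseteq> {n..<m}" "set B1 \<subseteq> {n..<m}"
      using less.prems tl unfolding A1_def B1_def by blast+
    have AB0: "comparable (Suc n) (worm A0) (worm B0)"
      using less.hyps[of A0 B0 "Suc n"] len set0 True by auto
    have AB1: "comparable n (worm A1) (worm B)" if a
      using less.hyps[of A1 B n] len1[OF that] set1 less.prems by auto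
    have BA1: "comparable n (worm A) (worm B1)" if b
      using less.hyps[of A B1 n] len2[OF that] set1 less.prems by auto
    show ?thesis
    proof (cases "entails (worm A) (\<^bold>\<langle>n\<^bold>\<rangle> worm B) \<or> entails (worm B) (\<^bold>\<langle>n\<^bold>\<rangle> worm A)")
      case True
      then show ?thesis by (auto simp: comparable_def)
    next
      case False
      \<comment> \<open>Otherwise the tail of \<open>A\<close> entails, or is equivalent to, a
        formula that puts \<open>B\<close> beyond \<open>A\<close>, contrary to the case
        assumption.\<close>
      have BA: "entails (worm B) (\<^bold>\<langle>n\<^bold>\<rangle> worm A1)" if a
      proof (rule ccontr)
        assume "\<not> ?thesis"
        then have "entails (worm A1) (\<^bold>\<langle>n\<^bold>\<rangle> worm B) \<or> equiv (worm A1) (worm B)"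
          using AB1[OF that] by (auto simp: comparable_def)
        then have "entails (\<^bold>\<langle>n\<^bold>\<rangle> worm A1) (\<^bold>\<langle>n\<^bold>\<rangle> worm B)"
          using entails_Dia[of "worm A1" "\<^bold>\<langle>n\<^bold>\<rangle> worm B" n] equiv_Dia[of "worm A1" "worm B" n] Dia_Dia
          unfolding entails_def equiv_def by blast
        then have "entails (worm A) (\<^bold>\<langle>n\<^bold>\<rangle> worm B)" using A that unfolding entails_def by blast
        then show False using False by blast
      qed
      have AB: "entails (worm A) (\<^bold>\<langle>n\<^bold>\<rangle> worm B1)" if b
      proof (rule ccontr)
        assume "\<not> ?thesis"
        then have "entails (worm B1) (\<^bold>\<langle>n\<^bold>\<rangle> worm A) \<or> equiv (worm A) (worm B1)"
          using BA1[OF that] by (auto simp: comparable_def)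
        then have "entails (\<^bold>\<langle>n\<^bold>\<rangle> worm B1) (\<^bold>\<langle>n\<^bold>\<rangle> worm A)"
          using entails_Dia[of "worm B1" "\<^bold>\<langle>n\<^bold>\<rangle> worm A" n] equiv_Dia[of "worm A" "worm B1" n] Dia_Dia
          unfolding entails_def equiv_def by blast
        then have "entails (worm B) (\<^bold>\<langle>n\<^bold>\<rangle> worm A)" using B that unfolding entails_def by blast
        then show False using False by blast
      qed
      \<comment> \<open>The (n+1)-successor where the head holds is also an n-successor, and by
        rigidity the tail is still possible there.\<close>
      have raise: "\<^bold>\<langle>n\<^bold>\<rangle> \<psi> \<in> x"
        if "\<^bold>\<langle>Suc n\<^bold>\<rangle> \<phi>0 \<in> x" "c \<longrightarrow> \<^bold>\<langle>n\<^bold>\<rangle> \<phi>1 \<in> x" "mcs x"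
          and "\<And>x. mcs x \<Longrightarrow> \<psi> \<in> x \<longleftrightarrow> \<phi>0 \<in> x \<and> (c \<longrightarrow> \<^bold>\<langle>n\<^bold>\<rangle> \<phi>1 \<in> x)" for \<phi>0 \<phi>1 \<psi> x c
        using that R_antimono_Suc[of n x] mcs_Dia[of x "Suc n" \<phi>0] mcs_Dia[of x n \<psi>]
          Dia_mcs_succ[of n "Suc n" x] R_mcs(2) by (metis lessI)
      consider "entails (worm A0) (\<^bold>\<langle>Suc n\<^bold>\<rangle> worm B0)" | "entails (worm B0) (\<^bold>\<langle>Suc n\<^bold>\<rangle> worm A0)"
        | "equiv (worm A0) (worm B0)" using AB0 by (auto simp: comparable_def)
      then show ?thesis
      proof cases
        case 1
        have "entails (worm A) (\<^bold>\<langle>n\<^bold>\<rangle> worm B)"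
          unfolding entails_def
        proof (intro allI impI)
          fix x assume x: "mcs x" "worm A \<in> x"
          show "\<^bold>\<langle>n\<^bold>\<rangle> worm B \<in> x"
            by (rule raise[OF _ _ x(1) B]) (use x A[OF x(1)] entailsD[OF 1 x(1)] entailsD[OF AB x(1)] in blast)+
        qed
        then show ?thesis using False by blast
      next
        case 2
        have "entails (worm B) (\<^bold>\<langle>n\<^bold>\<rangle> worm A)"
          unfolding entails_def
        proof (intro allI impI)
          fix x assume x: "mcs x" "worm B \<in> x"
          show "\<^bold>\<langle>n\<^bold>\<rangle> worm A \<in> x"
            by (rule raise[OF _ _ x(1) A]) (use x B[OF x(1)] entailsD[OF 2 x(1)] entailsD[OF BA x(1)] in blast)+
        qed
        then show ?thesis using False by blast
      next
        case 3
        then have "equiv (worm A) (worm B)"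
          using A B AB BA unfolding equiv_def entails_def by blast
        then show ?thesis by (simp add: comparable_def)
      qed
    qed
  qed
qed

section \<open>Least points of closed formulas\<close>

lemma minimal_iff: "mcs x \<Longrightarrow> minimal n \<phi> \<in> x \<longleftrightarrow> \<phi> \<in> x \<and> (\<forall>y. R n x y \<longrightarrow> \<phi> \<notin> y)"
  unfolding minimal_def using mcs_Conj mcs_Box mcs_Neg R_mcs(2) by metis

lemma Dia_minimal: "equiv (\<^bold>\<langle>n\<^bold>\<rangle> minimal n \<phi>) (\<^bold>\<langle>n\<^bold>\<rangle> \<phi>)"
  unfolding equiv_def using mcs_Dia minimal_iff Loeb_Dia R_mcs(2) by metis

lemma minimal_cong: "equiv \<phi> \<psi> \<Longrightarrow> equiv (minimal n \<phi>) (minimal n \<psi>)"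
  unfolding equiv_def using minimal_iff R_mcs(2) by metis

text \<open>A formula lying between \<open>minimal n \<phi>\<close> and \<open>\<phi>\<close> is
  n-possible at the same worlds as \<open>\<phi>\<close>, by Loeb's axiom, and therefore has the
  same least points.\<close>

lemma minimal_eqI:
  assumes "entails \<psi> \<phi>" "entails (minimal n \<phi>) \<psi>"
  shows "equiv (minimal n \<phi>) (minimal n \<psi>)"
  unfolding equiv_def
proof (intro allI impI)
  fix x assume x: "mcs x"
  have "(\<exists>y. R n x y \<and> \<phi> \<in> y) \<longleftrightarrow> (\<exists>y. R n x y \<and> \<psi> \<in> y)"
    using assms Loeb_Dia[of n x _ \<phi>] minimal_iff R_mcs(2) unfolding entails_def by metis
  then show "minimal n \<phi> \<in> x \<longleftrightarrow> minimal n \<psi> \<in> x"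
    using assms x unfolding minimal_iff[OF x] entails_def by (metis minimal_iff)
qed

definition inconsistent :: "fm \<Rightarrow> bool" where
  "inconsistent \<phi> \<longleftrightarrow> (\<forall>x. mcs x \<longrightarrow> \<phi> \<notin> x)"

text \<open>The least point of a consistent closed formula is the least point of a worm.\<close>

definition wormlike :: "nat \<Rightarrow> nat \<Rightarrow> fm \<Rightarrow> bool" where
  "wormlike n m \<phi> \<longleftrightarrow> inconsistent \<phi> \<or>
    (\<exists>A. set A \<subseteq> {n..<m} \<and> equiv (minimal n \<phi>) (minimal n (worm A)))"

lemma wormlike_cong: "equiv \<phi> \<psi> \<Longrightarrow> wormlike n m \<phi> \<Longrightarrow> wormlike n m \<psi>"
  using minimal_cong[of \<phi> \<psi> n] by (auto simp: wormlike_def inconsistent_def equiv_def)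

text \<open>If one worm entails that the other is n-possible, a least point of the first sees a
  point of the other disjunct and cannot be least for the disjunction. So the least points come from
  the worm that lies further along.\<close>

lemma wormlike_Disj:
  assumes "wormlike n m \<phi>" "wormlike n m \<psi>"
  shows "wormlike n m (\<phi> \<^bold>\<or> \<psi>)"
proof -
  have *: "wormlike n m (\<phi> \<^bold>\<or> \<psi>)"
    if A: "set A \<subseteq> {n..<m}" "equiv (minimal n \<phi>) (minimal n (worm A))"
      and "entails (minimal n (\<phi> \<^bold>\<or> \<psi>)) (minimal n (worm A))" for A \<phi> \<psi>
  proof -
    have "entails (minimal n (worm A)) (\<phi> \<^bold>\<or> \<psi>)"
      using A(2) unfolding entails_def equiv_def by (auto simp: minimal_iff)
    then have "equiv (minimal n (\<phi> \<^bold>\<or> \<psi>)) (minimal n (minimal n (worm A)))"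
      using that(3) by (rule minimal_eqI)
    moreover have "equiv (minimal n (worm A)) (minimal n (minimal n (worm A)))"
      by (rule minimal_eqI) (auto simp: entails_def minimal_iff)
    ultimately show ?thesis using A(1) unfolding wormlike_def by (meson equiv_sym equiv_trans)
  qed
  have or: "minimal n \<phi> \<in> x \<or> minimal n \<psi> \<in> x" if "minimal n (\<phi> \<^bold>\<or> \<psi>) \<in> x" "mcs x" for x
    using that R_mcs(2)[of n x] by (auto simp: minimal_iff)
  have swap: "wormlike n m (\<psi> \<^bold>\<or> \<phi>) \<Longrightarrow> ?thesis"
    by (erule wormlike_cong[rotated]) (auto simp: equiv_def)
  show ?thesis
  proof (cases "inconsistent \<phi> \<or> inconsistent \<psi>")
    case True
    then have "equiv \<psi> (\<phi> \<^bold>\<or> \<psi>) \<or> equiv \<phi> (\<phi> \<^bold>\<or> \<psi>)"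
      by (auto simp: inconsistent_def equiv_def)
    then show ?thesis using assms wormlike_cong by blast
  next
    case False
    then obtain A B where A: "set A \<subseteq> {n..<m}" "equiv (minimal n \<phi>) (minimal n (worm A))"
      and B: "set B \<subseteq> {n..<m}" "equiv (minimal n \<psi>) (minimal n (worm B))"
      using assms by (auto simp: wormlike_def)
    have below: "False" if x: "mcs x" "minimal n (\<phi>' \<^bold>\<or> \<psi>') \<in> x" "minimal n (worm A') \<in> x"
      and "entails (worm A') (\<^bold>\<langle>n\<^bold>\<rangle> worm B')" "equiv (minimal n \<psi>') (minimal n (worm B'))" for x A' B' \<phi>' \<psi>'
    proof -
      have "\<^bold>\<langle>n\<^bold>\<rangle> worm B' \<in> x" using that entailsD minimal_iff by metis
      then have "\<^bold>\<langle>n\<^bold>\<rangle> minimal n (worm B') \<in> x" using equivD[OF Dia_minimal x(1)] by blast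
      then obtain y where y: "R n x y" "minimal n (worm B') \<in> y" using mcs_Dia[OF x(1)] by blast
      then have "\<psi>' \<in> y" using that(5) R_mcs(2) minimal_iff unfolding equiv_def by metis
      then show False using x y(1) R_mcs(2) mcs_Disj minimal_iff by metis
    qed
    consider "entails (worm A) (\<^bold>\<langle>n\<^bold>\<rangle> worm B)" | "entails (worm B) (\<^bold>\<langle>n\<^bold>\<rangle> worm A)" | "equiv (worm A) (worm B)"
      using worms_comparable[OF A(1) B(1)] by (auto simp: comparable_def)
    then show ?thesis
    proof cases
      case 1
      have "entails (minimal n (\<psi> \<^bold>\<or> \<phi>)) (minimal n (worm B))"
        unfolding entails_def
        using below[of _ \<phi> \<psi> A B] 1 A B or unfolding equiv_def
        by (metis (no_types, lifting) minimal_iff mcs_Disj R_mcs(2))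
      then show ?thesis using *[OF B] swap by blast
    next
      case 2
      have "entails (minimal n (\<phi> \<^bold>\<or> \<psi>)) (minimal n (worm A))"
        unfolding entails_def
        using below[of _ \<psi> \<phi> B A] 2 A B or unfolding equiv_def
        by (metis (no_types, lifting) minimal_iff mcs_Disj R_mcs(2))
      then show ?thesis using *[OF A] by blast
    next
      case 3
      then have "entails (minimal n (\<phi> \<^bold>\<or> \<psi>)) (minimal n (worm A))"
        unfolding entails_def using or A B minimal_cong[OF 3, of n] unfolding equiv_def by blast
      then show ?thesis using *[OF A] by blast
    qed
  qed
qed

lemma inconsistent_minimal: "inconsistent (minimal n \<phi>) \<longleftrightarrow> inconsistent \<phi>"
  unfolding inconsistent_def using minimal_iff Loeb_Dia R_mcs(2) by metis

lemma wormlike_minimal_cong: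
  "equiv (minimal n \<phi>) (minimal n \<psi>) \<Longrightarrow> wormlike n m \<psi> \<Longrightarrow> wormlike n m \<phi>"
  using inconsistent_minimal[of n \<phi>] inconsistent_minimal[of n \<psi>]
  unfolding wormlike_def by (metis equiv_trans inconsistent_def equivD)

lemma minimal_idem: "equiv (minimal n \<phi>) (minimal n (minimal n \<phi>))"
  by (rule minimal_eqI) (auto simp: entails_def minimal_iff)

section \<open>Normal forms of closed formulas\<close>

definition level :: "nat \<Rightarrow> nat \<Rightarrow> fm \<Rightarrow> bool" where
  "level n m \<phi> \<longleftrightarrow> closed_fm \<phi> \<and> modalities \<phi> \<subseteq> {n..<m}"

text \<open>Members of this set and of \<open>upper_bounds\<close> bound the n-depth of a world from
  below and above. Because worms are totally ordered, a conjunction of bounds of one kind is again a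
  single bound.\<close>

definition lower_bounds :: "nat \<Rightarrow> nat \<Rightarrow> fm set" where
  "lower_bounds n m = insert \<^bold>\<top> {\<^bold>\<langle>n\<^bold>\<rangle> worm A | A. set A \<subseteq> {n..<m}}"

definition upper_bounds :: "nat \<Rightarrow> nat \<Rightarrow> fm set" where
  "upper_bounds n m = insert \<^bold>\<top> {\<^bold>[n\<^bold>] \<^bold>\<not> worm A | A. set A \<subseteq> {n..<m}}"

text \<open>Closure under \<open>equiv\<close> is built in, so that closure under the connectives
  can be shown without computing a normal form.\<close>

inductive dnf :: "nat \<Rightarrow> nat \<Rightarrow> fm \<Rightarrow> bool" for n m where
  clause: "level (Suc n) m \<epsilon> \<Longrightarrow> l \<in> lower_bounds n m \<Longrightarrow> u \<in> upper_bounds n m \<Longrightarrow> dnf n m (\<epsilon> \<^bold>\<and> l \<^bold>\<and> u)"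
| disj: "dnf n m \<phi> \<Longrightarrow> dnf n m \<psi> \<Longrightarrow> dnf n m (\<phi> \<^bold>\<or> \<psi>)"
| equivalent: "dnf n m \<phi> \<Longrightarrow> equiv \<phi> \<psi> \<Longrightarrow> dnf n m \<psi>"

lemma Dia_worms_total:
  assumes "set A \<subseteq> {n..<m}" "set B \<subseteq> {n..<m}"
  shows "entails (\<^bold>\<langle>n\<^bold>\<rangle> worm A) (\<^bold>\<langle>n\<^bold>\<rangle> worm B) \<or> entails (\<^bold>\<langle>n\<^bold>\<rangle> worm B) (\<^bold>\<langle>n\<^bold>\<rangle> worm A)"
proof -
  have "entails (\<^bold>\<langle>n\<^bold>\<rangle> \<phi>) (\<^bold>\<langle>n\<^bold>\<rangle> \<psi>)" if "entails \<phi> (\<^bold>\<langle>n\<^bold>\<rangle> \<psi>) \<or> equiv \<phi> \<psi>" for \<phi> \<psi>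
    using that entails_Dia[of \<phi> _ n] Dia_Dia equiv_Dia[of \<phi> \<psi> n] unfolding entails_def equiv_def by blast
  then show ?thesis using worms_comparable[OF assms] unfolding comparable_def by blast
qed

lemma lower_bounds_Conj:
  assumes "l \<in> lower_bounds n m" "l' \<in> lower_bounds n m"
  shows "\<exists>l''\<in>lower_bounds n m. equiv l'' (l \<^bold>\<and> l')"
proof -
  have "entails l l' \<or> entails l' l"
    using assms unfolding lower_bounds_def
    by (elim insertE CollectE exE conjE) (use Dia_worms_total in \<open>auto simp: entails_def\<close>)
  then have "equiv l (l \<^bold>\<and> l') \<or> equiv l' (l \<^bold>\<and> l')" by (auto simp: entails_def equiv_def)
  then show ?thesis using assms by blast
qed

lemma upper_bounds_Conj:
  assumes "l \<in> upper_bounds n m" "l' \<in> upper_bounds n m"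
  shows "\<exists>l''\<in>upper_bounds n m. equiv l'' (l \<^bold>\<and> l')"
proof -
  have "entails l l' \<or> entails l' l"
  proof (cases "l = \<^bold>\<top> \<or> l' = \<^bold>\<top>")
    case True
    then show ?thesis by (auto simp: entails_def)
  next
    case False
    then obtain A B where "l = \<^bold>[n\<^bold>] \<^bold>\<not> worm A" "set A \<subseteq> {n..<m}" "l' = \<^bold>[n\<^bold>] \<^bold>\<not> worm B" "set B \<subseteq> {n..<m}"
      using assms by (auto simp: upper_bounds_def)
    then show ?thesis using Dia_worms_total[of A n m B] by (simp add: entails_def) blast
  qed
  then have "equiv l (l \<^bold>\<and> l') \<or> equiv l' (l \<^bold>\<and> l')" by (auto simp: entails_def equiv_def)
  then show ?thesis using assms by blast
qed

lemma bounds_rigid: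
  assumes "l \<in> lower_bounds n m \<union> upper_bounds n m" "n < k" "R k x y"
  shows "l \<in> x \<longleftrightarrow> l \<in> y"
  using assms Dia_mcs_succ[OF assms(2,3)] R_Box_iff[OF assms(2,3)] R_mcs[OF assms(3)]
  by (auto simp: lower_bounds_def upper_bounds_def simp del: mcs_Neg)

lemma dnf_intros:
  "level (Suc n) m \<epsilon> \<Longrightarrow> dnf n m \<epsilon>"
  "l \<in> lower_bounds n m \<Longrightarrow> dnf n m l"
  "l \<in> upper_bounds n m \<Longrightarrow> dnf n m l"
proof -
  have T: "\<^bold>\<top> \<in> lower_bounds n m" "\<^bold>\<top> \<in> upper_bounds n m" "level (Suc n) m \<^bold>\<top>"
    by (auto simp: lower_bounds_def upper_bounds_def level_def closed_fm_def)
  show "level (Suc n) m \<epsilon> \<Longrightarrow> dnf n m \<epsilon>"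
    using dnf.equivalent[OF dnf.clause[of n m \<epsilon>, OF _ T(1,2)], of \<epsilon>] by (simp add: equiv_def)
  show "l \<in> lower_bounds n m \<Longrightarrow> dnf n m l"
    using dnf.equivalent[OF dnf.clause[of n m _ l, OF T(3) _ T(2)], of l] by (simp add: equiv_def)
  show "l \<in> upper_bounds n m \<Longrightarrow> dnf n m l"
    using dnf.equivalent[OF dnf.clause[of n m _ _ l, OF T(3,1)], of l] by (simp add: equiv_def)
qed

lemma dnf_Conj:
  assumes "dnf n m \<phi>" "dnf n m \<psi>"
  shows "dnf n m (\<phi> \<^bold>\<and> \<psi>)"
  using assms
proof (induction rule: dnf.induct)
  case (clause \<epsilon> l u)
  from clause(4,1-3) show ?case
  proof (induction rule: dnf.induct)
    case (clause \<epsilon>' l' u')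
    obtain l'' u'' where "l'' \<in> lower_bounds n m" "equiv l'' (l \<^bold>\<and> l')"
      "u'' \<in> upper_bounds n m" "equiv u'' (u \<^bold>\<and> u')"
      using lower_bounds_Conj upper_bounds_Conj clause by metis
    moreover from this have "dnf n m ((\<epsilon> \<^bold>\<and> \<epsilon>') \<^bold>\<and> l'' \<^bold>\<and> u'')"
      using clause by (intro dnf.clause) (auto simp: level_def closed_fm_def)
    ultimately show ?case by (elim dnf.equivalent) (auto simp: equiv_def)
  next
    case (disj \<phi> \<psi>)
    then have "dnf n m ((\<epsilon> \<^bold>\<and> l \<^bold>\<and> u) \<^bold>\<and> \<phi> \<^bold>\<or> (\<epsilon> \<^bold>\<and> l \<^bold>\<and> u) \<^bold>\<and> \<psi>)" by (intro dnf.disj) auto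
    then show ?case by (rule dnf.equivalent) (auto simp: equiv_def)
  next
    case (equivalent \<phi> \<psi>)
    then show ?case by - (rule dnf.equivalent[of n m "(\<epsilon> \<^bold>\<and> l \<^bold>\<and> u) \<^bold>\<and> \<phi>"], auto simp: equiv_def)
  qed
next
  case (disj \<phi> \<phi>')
  then have "dnf n m (\<phi> \<^bold>\<and> \<psi> \<^bold>\<or> \<phi>' \<^bold>\<and> \<psi>)" by (intro dnf.disj) auto
  then show ?case by (rule dnf.equivalent) (auto simp: equiv_def)
next
  case (equivalent \<phi> \<phi>')
  then show ?case by - (rule dnf.equivalent[of n m "\<phi> \<^bold>\<and> \<psi>"], auto simp: equiv_def)
qed

lemma dnf_Neg: "dnf n m \<phi> \<Longrightarrow> dnf n m (\<^bold>\<not> \<phi>)"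
proof (induction rule: dnf.induct)
  case (clause \<epsilon> l u)
  have "dnf n m (\<^bold>\<not> \<epsilon>)" using clause by (intro dnf_intros) (simp add: level_def closed_fm_def)
  moreover have F: "dnf n m \<^bold>\<bottom>" by (intro dnf_intros) (simp add: level_def closed_fm_def)
  have "dnf n m (\<^bold>\<not> l)"
  proof (cases "l = \<^bold>\<top>")
    case False
    then obtain A where A: "l = \<^bold>\<langle>n\<^bold>\<rangle> worm A" "set A \<subseteq> {n..<m}" using clause by (auto simp: lower_bounds_def)
    then have "dnf n m (\<^bold>[n\<^bold>] \<^bold>\<not> worm A)" by (intro dnf_intros(3)) (auto simp: upper_bounds_def)
    then show ?thesis by (rule dnf.equivalent) (simp add: equiv_def A)
  qed (use F in simp)
  moreover have "dnf n m (\<^bold>\<not> u)"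
  proof (cases "u = \<^bold>\<top>")
    case False
    then obtain A where A: "u = \<^bold>[n\<^bold>] \<^bold>\<not> worm A" "set A \<subseteq> {n..<m}" using clause by (auto simp: upper_bounds_def)
    then show ?thesis by (intro dnf_intros(2)) (auto simp: lower_bounds_def)
  qed (use F in simp)
  ultimately have "dnf n m (\<^bold>\<not> \<epsilon> \<^bold>\<or> \<^bold>\<not> l \<^bold>\<or> \<^bold>\<not> u)" by (intro dnf.disj)
  then show ?case by (rule dnf.equivalent) (auto simp: equiv_def)
next
  case (disj \<phi> \<psi>)
  then have "dnf n m (\<^bold>\<not> \<phi> \<^bold>\<and> \<^bold>\<not> \<psi>)" by (intro dnf_Conj) auto
  then show ?case by (rule dnf.equivalent) (auto simp: equiv_def)
next
  case (equivalent \<phi> \<psi>)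
  then show ?case by - (rule dnf.equivalent[of n m "\<^bold>\<not> \<phi>"], auto simp: equiv_def)
qed

text \<open>Bounds at level \<open>n\<close> are rigid along \<open>k > n\<close>, so the diamond
  passes them and acts on the higher-level part of a clause alone.\<close>

lemma dnf_Dia:
  assumes "dnf n m \<phi>" "n < k" "k < m"
  shows "dnf n m (\<^bold>\<langle>k\<^bold>\<rangle> \<phi>)"
  using assms(1)
proof (induction rule: dnf.induct)
  case (clause \<epsilon> l u)
  then have "dnf n m (\<^bold>\<langle>k\<^bold>\<rangle> \<epsilon> \<^bold>\<and> l \<^bold>\<and> u)"
    using assms by (intro dnf.clause) (auto simp: level_def closed_fm_def)
  moreover have "equiv (\<^bold>\<langle>k\<^bold>\<rangle> \<epsilon> \<^bold>\<and> l \<^bold>\<and> u) (\<^bold>\<langle>k\<^bold>\<rangle> (\<epsilon> \<^bold>\<and> l \<^bold>\<and> u))"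
    unfolding equiv_def
  proof (intro allI impI)
    fix x assume x: "mcs x"
    show "\<^bold>\<langle>k\<^bold>\<rangle> \<epsilon> \<^bold>\<and> l \<^bold>\<and> u \<in> x \<longleftrightarrow> \<^bold>\<langle>k\<^bold>\<rangle> (\<epsilon> \<^bold>\<and> l \<^bold>\<and> u) \<in> x"
      unfolding mcs_Conj[OF x] mcs_Dia[OF x]
      using bounds_rigid[of l n m k x] bounds_rigid[of u n m k x] clause assms(2) mcs_Conj R_mcs(2)
      by blast
  qed
  ultimately show ?case by (rule dnf.equivalent)
next
  case (disj \<phi> \<psi>)
  then have "dnf n m (\<^bold>\<langle>k\<^bold>\<rangle> \<phi> \<^bold>\<or> \<^bold>\<langle>k\<^bold>\<rangle> \<psi>)" by (intro dnf.disj)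
  moreover have "equiv (\<^bold>\<langle>k\<^bold>\<rangle> \<phi> \<^bold>\<or> \<^bold>\<langle>k\<^bold>\<rangle> \<psi>) (\<^bold>\<langle>k\<^bold>\<rangle> (\<phi> \<^bold>\<or> \<psi>))"
    unfolding equiv_def using mcs_Disj mcs_Dia R_mcs(2) by metis
  ultimately show ?case by (rule dnf.equivalent)
next
  case (equivalent \<phi> \<psi>)
  then show ?case using dnf.equivalent equiv_Dia by blast
qed

text \<open>If a rigid conjunct holds at a point, it holds at all \<open>n + 1\<close>-successors, so a least point of
  the conjunction is also a least point of the other conjunct with respect to \<open>n + 1\<close>.\<close>

lemma minimal_Conj_rigid:
  assumes rigid: "\<And>x y. R (Suc n) x y \<Longrightarrow> \<rho> \<in> x \<longleftrightarrow> \<rho> \<in> y"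
  shows "equiv (minimal n (\<epsilon> \<^bold>\<and> \<rho>)) (minimal n (minimal (Suc n) \<epsilon> \<^bold>\<and> \<rho>))"
proof (rule minimal_eqI)
  show "entails (minimal (Suc n) \<epsilon> \<^bold>\<and> \<rho>) (\<epsilon> \<^bold>\<and> \<rho>)" by (auto simp: entails_def minimal_iff)
  show "entails (minimal n (\<epsilon> \<^bold>\<and> \<rho>)) (minimal (Suc n) \<epsilon> \<^bold>\<and> \<rho>)"
    unfolding entails_def
  proof (intro allI impI)
    fix x assume x: "mcs x" "minimal n (\<epsilon> \<^bold>\<and> \<rho>) \<in> x"
    then have "\<epsilon> \<notin> y" if "R (Suc n) x y" for y
      using rigid[OF that] R_antimono_Suc[OF that] R_mcs(2)[OF that] by (auto simp: minimal_iff)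
    then show "minimal (Suc n) \<epsilon> \<^bold>\<and> \<rho> \<in> x" using x by (simp add: minimal_iff)
  qed
qed

text \<open>Both bounds are rigid along \<open>n + 1\<close>, so \<open>\<epsilon>\<close> may be
  replaced by its worm \<open>A\<close>; a lower bound is absorbed by appending \<open>n # W\<close>
  to \<open>A\<close>. The resulting worm \<open>X\<close> is then compared with the worm of the
  upper bound: the clause is contradictory, or says that \<open>X\<close> holds for the last time,
  or has the least points of \<open>X\<close>, where the bound is automatic.\<close>

lemma clause_wormlike:
  assumes \<epsilon>: "wormlike (Suc n) m \<epsilon>" and l: "l \<in> lower_bounds n m" and u: "u \<in> upper_bounds n m"
    and "n < m"
  shows "wormlike n m (\<epsilon> \<^bold>\<and> l \<^bold>\<and> u)"
proof (cases "inconsistent \<epsilon>")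
  case True
  then show ?thesis by (auto simp: wormlike_def inconsistent_def)
next
  case False
  then obtain A where A: "set A \<subseteq> {Suc n..<m}" "equiv (minimal (Suc n) \<epsilon>) (minimal (Suc n) (worm A))"
    using \<epsilon> by (auto simp: wormlike_def)
  have rigid: "l \<^bold>\<and> u \<in> x \<longleftrightarrow> l \<^bold>\<and> u \<in> y" if "R (Suc n) x y" for x y
    using bounds_rigid[OF _ _ that, of _ n m] l u R_mcs[OF that] by auto
  have "equiv (minimal n (minimal (Suc n) \<epsilon> \<^bold>\<and> l \<^bold>\<and> u)) (minimal n (minimal (Suc n) (worm A) \<^bold>\<and> l \<^bold>\<and> u))"
    using A(2) by (intro minimal_cong) (auto simp: equiv_def)
  then have red: "equiv (minimal n (\<epsilon> \<^bold>\<and> l \<^bold>\<and> u)) (minimal n (worm A \<^bold>\<and> l \<^bold>\<and> u))"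
    using minimal_Conj_rigid[OF rigid] equiv_sym equiv_trans by blast
  obtain X where X: "set X \<subseteq> {n..<m}" "\<And>x. mcs x \<Longrightarrow> worm X \<in> x \<longleftrightarrow> worm A \<in> x \<and> l \<in> x"
  proof (cases "l = \<^bold>\<top>")
    case True
    then show ?thesis using that[of A] A(1) by fastforce
  next
    case False
    then obtain W where W: "l = \<^bold>\<langle>n\<^bold>\<rangle> worm W" "set W \<subseteq> {n..<m}" using l by (auto simp: lower_bounds_def)
    have "worm (A @ n # W) \<in> x \<longleftrightarrow> worm A \<in> x \<and> l \<in> x" if "mcs x" for x
      using worm_append[of A n x W] A(1) that unfolding W(1) by fastforce
    then show ?thesis using that[of "A @ n # W"] W A(1) \<open>n < m\<close> by fastforce
  qed
  have Xu: "equiv (worm A \<^bold>\<and> l \<^bold>\<and> u) (worm X \<^bold>\<and> u)" using X by (auto simp: equiv_def)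
  have "wormlike n m (worm X \<^bold>\<and> u)"
  proof (cases "u = \<^bold>\<top>")
    case True
    then have "equiv (worm X) (worm X \<^bold>\<and> u)" by (simp add: equiv_def)
    moreover have "wormlike n m (worm X)" using X(1) equiv_refl by (auto simp: wormlike_def)
    ultimately show ?thesis by (rule wormlike_cong)
  next
    case False
    then obtain V where V: "u = \<^bold>[n\<^bold>] \<^bold>\<not> worm V" "set V \<subseteq> {n..<m}" using u by (auto simp: upper_bounds_def)
    have u_iff: "u \<in> x \<longleftrightarrow> \<^bold>\<langle>n\<^bold>\<rangle> worm V \<notin> x" if "mcs x" for x using V that by simp
    consider "entails (worm X) (\<^bold>\<langle>n\<^bold>\<rangle> worm V)" | "equiv (worm X) (worm V)" | "entails (worm V) (\<^bold>\<langle>n\<^bold>\<rangle> worm X)"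
      using worms_comparable[OF X(1) V(2)] by (auto simp: comparable_def)
    then show ?thesis
    proof cases
      case 1
      then have "inconsistent (worm X \<^bold>\<and> u)" using u_iff unfolding inconsistent_def entails_def by (metis mcs_Conj)
      then show ?thesis by (simp add: wormlike_def)
    next
      case 2
      then have "equiv (minimal n (worm X)) (worm X \<^bold>\<and> u)"
        using equiv_Dia[OF 2, of n] unfolding V(1) equiv_def minimal_def by (simp del: mcs_Neg) (metis mcs_Neg)
      then have "equiv (minimal n (worm X \<^bold>\<and> u)) (minimal n (worm X))"
        using minimal_cong minimal_idem equiv_sym equiv_trans by blast
      then show ?thesis using X(1) by (auto simp: wormlike_def)
    next
      case 3
      have "equiv (minimal n (worm X)) (minimal n (worm X \<^bold>\<and> u))"
      proof (rule minimal_eqI)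
        show "entails (worm X \<^bold>\<and> u) (worm X)" by (simp add: entails_def)
        show "entails (minimal n (worm X)) (worm X \<^bold>\<and> u)"
          unfolding entails_def
        proof (intro allI impI)
          fix x assume x: "mcs x" "minimal n (worm X) \<in> x"
          have "\<^bold>\<langle>n\<^bold>\<rangle> worm V \<notin> x"
          proof
            assume "\<^bold>\<langle>n\<^bold>\<rangle> worm V \<in> x"
            then have "\<^bold>\<langle>n\<^bold>\<rangle> worm X \<in> x" using entails_Dia[OF 3, of n] entailsD Dia_Dia x(1) by blast
            then show False using x mcs_Dia minimal_iff by blast
          qed
          then show "worm X \<^bold>\<and> u \<in> x" using x u_iff minimal_iff by simp
        qed
      qed
      then show ?thesis using X(1) equiv_sym by (auto simp: wormlike_def)
    qed
  qed
  then have "wormlike n m (worm A \<^bold>\<and> l \<^bold>\<and> u)" using Xu equiv_sym wormlike_cong by blast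
  then show ?thesis using red wormlike_minimal_cong by blast
qed

text \<open>Normal forms and worms support each other inside a level: clauses reduce to worms
  through the previous level, and worms in turn provide the normal form of a formula that begins
  with the diamond \<open>n\<close>.\<close>

lemma level_wormlike: "level n m \<phi> \<Longrightarrow> wormlike n m \<phi>"
proof (induction "m - n" arbitrary: n \<phi>)
  case 0
  have "equiv \<phi> \<^bold>\<top> \<or> inconsistent \<phi>" if "closed_fm \<phi>" "modalities \<phi> = {}" for \<phi>
    using that by (induction \<phi>) (auto simp: closed_fm_def equiv_def inconsistent_def)
  moreover have "{n..<m} = {}" using 0(1) by simp
  ultimately have "equiv \<phi> \<^bold>\<top> \<or> inconsistent \<phi>" using 0(2) unfolding level_def by blast
  then show ?case
    using minimal_cong[of \<phi> "\<^bold>\<top>" n] by (auto simp: wormlike_def intro: exI[of _ "[]"])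
next
  case (Suc d)
  then have "n < m" by simp
  have IH: "level (Suc n) m \<epsilon> \<Longrightarrow> wormlike (Suc n) m \<epsilon>" for \<epsilon>
    using Suc(1)[of "Suc n"] Suc(2) by simp
  have dnf_wormlike: "wormlike n m \<psi>" if "dnf n m \<psi>" for \<psi>
    using that
  proof (induction rule: dnf.induct)
    case (clause \<epsilon> l u)
    then show ?case using clause_wormlike IH \<open>n < m\<close> by blast
  next
    case (disj \<phi> \<psi>)
    then show ?case by (intro wormlike_Disj)
  next
    case (equivalent \<phi> \<psi>)
    then show ?case using wormlike_cong by blast
  qed
  \<comment> \<open>By Loeb's axiom an n-diamond depends only on the least points of its argument,
    so it is a lower bound given by a worm.\<close>
  have Dia: "dnf n m (\<^bold>\<langle>n\<^bold>\<rangle> \<psi>)" if \<psi>: "dnf n m \<psi>" for \<psi>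
  proof (cases "inconsistent \<psi>")
    case True
    then have "equiv \<^bold>\<bottom> (\<^bold>\<langle>n\<^bold>\<rangle> \<psi>)" unfolding inconsistent_def equiv_def using mcs_Dia R_mcs(2) by (metis mcs_Neg mcs_Verum)
    moreover have "dnf n m \<^bold>\<bottom>" by (intro dnf_intros) (simp add: level_def closed_fm_def)
    ultimately show ?thesis by (rule dnf.equivalent[rotated])
  next
    case False
    then obtain A where A: "set A \<subseteq> {n..<m}" "equiv (minimal n \<psi>) (minimal n (worm A))"
      using dnf_wormlike[OF \<psi>] by (auto simp: wormlike_def)
    then have "dnf n m (\<^bold>\<langle>n\<^bold>\<rangle> worm A)" by (intro dnf_intros(2)) (auto simp: lower_bounds_def)
    moreover have "equiv (\<^bold>\<langle>n\<^bold>\<rangle> worm A) (\<^bold>\<langle>n\<^bold>\<rangle> \<psi>)"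
      using A(2) Dia_minimal equiv_Dia equiv_sym equiv_trans by metis
    ultimately show ?thesis by (rule dnf.equivalent)
  qed
  have "dnf n m \<phi>" if "level n m \<phi>" for \<phi>
    using that
  proof (induction \<phi>)
    case (Var p)
    then show ?case by (simp add: level_def closed_fm_def)
  next
    case Verum
    then show ?case by (intro dnf_intros) (simp add: level_def closed_fm_def)
  next
    case (Neg \<phi>)
    then show ?case using dnf_Neg by (simp add: level_def closed_fm_def)
  next
    case (Conj \<phi> \<psi>)
    then show ?case using dnf_Conj by (simp add: level_def closed_fm_def)
  next
    case (Disj \<phi> \<psi>)
    then show ?case using dnf.disj by (simp add: level_def closed_fm_def)
  next
    case (Imp \<phi> \<psi>)
    then have "dnf n m (\<^bold>\<not> \<phi> \<^bold>\<or> \<psi>)" using dnf.disj dnf_Neg by (simp add: level_def closed_fm_def)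
    then show ?case by (rule dnf.equivalent) (auto simp: equiv_def)
  next
    case (Box k \<phi>)
    then have k: "n \<le> k" "k < m" and "dnf n m (\<^bold>\<not> \<phi>)"
      using dnf_Neg by (auto simp: level_def closed_fm_def)
    then have "dnf n m (\<^bold>\<langle>k\<^bold>\<rangle> \<^bold>\<not> \<phi>)" using Dia dnf_Dia by (cases "k = n") auto
    then have "dnf n m (\<^bold>\<not> \<^bold>\<langle>k\<^bold>\<rangle> \<^bold>\<not> \<phi>)" by (rule dnf_Neg)
    moreover have "equiv (\<^bold>\<not> \<^bold>\<langle>k\<^bold>\<rangle> \<^bold>\<not> \<phi>) (\<^bold>[k\<^bold>] \<phi>)"
      unfolding equiv_def using equivD[OF equiv_Box[of "\<^bold>\<not> \<^bold>\<not> \<phi>" \<phi> k]] by (simp add: equiv_def)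
    ultimately show ?case by (rule dnf.equivalent)
  qed
  then show ?case using dnf_wormlike Suc.prems by blast
qed

text \<open>The worms of \<open>\<phi>\<close> and \<open>\<psi>\<close> are comparable, so at one
  of the two least points below \<open>x\<close> the other formula holds or is n-possible.\<close>

lemma level_linear:
  assumes \<phi>: "level n m \<phi>" and \<psi>: "level n m \<psi>" and y: "R n x y" "\<phi> \<in> y" and z: "R n x z" "\<psi> \<in> z"
  shows "\<exists>w. R n x w \<and> (\<phi> \<in> w \<and> \<psi> \<in> w \<or> \<phi> \<in> w \<and> \<^bold>\<langle>n\<^bold>\<rangle> \<psi> \<in> w \<or> \<psi> \<in> w \<and> \<^bold>\<langle>n\<^bold>\<rangle> \<phi> \<in> w)"
proof -
  have "\<not> inconsistent \<phi>" "\<not> inconsistent \<psi>" using y z R_mcs(2) by (auto simp: inconsistent_def)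
  then obtain A B where A: "set A \<subseteq> {n..<m}" "equiv (minimal n \<phi>) (minimal n (worm A))"
    and B: "set B \<subseteq> {n..<m}" "equiv (minimal n \<psi>) (minimal n (worm B))"
    using level_wormlike[OF \<phi>] level_wormlike[OF \<psi>] by (auto simp: wormlike_def)
  obtain y' z' where y': "R n x y'" "minimal n \<phi> \<in> y'" and z': "R n x z'" "minimal n \<psi> \<in> z'"
    using Loeb_Dia[OF y] Loeb_Dia[OF z] by (metis minimal_iff R_mcs(2))
  have m: "mcs y'" "mcs z'" using y' z' R_mcs(2) by auto
  have Dia: "\<^bold>\<langle>n\<^bold>\<rangle> \<chi>' \<in> v"
    if v: "minimal n \<chi> \<in> v" "mcs v" and "entails (worm C) (\<^bold>\<langle>n\<^bold>\<rangle> worm C')" "equiv (minimal n \<chi>) (minimal n (worm C))"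
      "equiv (minimal n \<chi>') (minimal n (worm C'))" for \<chi> \<chi>' C C' v
  proof -
    have "worm C \<in> v" using that minimal_iff equivD by blast
    then have "\<^bold>\<langle>n\<^bold>\<rangle> minimal n (worm C') \<in> v" using that entailsD equivD[OF Dia_minimal] by blast
    then show ?thesis
      using equivD[OF equiv_Dia[OF that(5)]] equivD[OF Dia_minimal] v(2) by blast
  qed
  consider "entails (worm A) (\<^bold>\<langle>n\<^bold>\<rangle> worm B)" | "entails (worm B) (\<^bold>\<langle>n\<^bold>\<rangle> worm A)" | "equiv (worm A) (worm B)"
    using worms_comparable[OF A(1) B(1)] by (auto simp: comparable_def)
  then show ?thesis
  proof cases
    case 1
    then show ?thesis using Dia[OF y'(2) m(1) 1 A(2) B(2)] y' minimal_iff[OF m(1)] by blast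
  next
    case 2
    then show ?thesis using Dia[OF z'(2) m(2) 2 B(2) A(2)] z' minimal_iff[OF m(2)] by blast
  next
    case 3
    then have "minimal n \<psi> \<in> y'"
      using minimal_cong[OF 3, of n] A(2) B(2) y'(2) m(1) unfolding equiv_def by blast
    then show ?thesis using y' minimal_iff[OF m(1)] by blast
  qed
qed

text \<open>Boxes below \<open>n\<close> have constant truth values on the \<open>n\<close>-successors of a point.\<close>

lemma relative_level:
  assumes "closed_fm \<phi>" "modalities \<phi> \<subseteq> {..<m}"
  shows "\<exists>\<psi>. level n m \<psi> \<and> (\<forall>y. R n x y \<longrightarrow> (\<phi> \<in> y \<longleftrightarrow> \<psi> \<in> y))"
  using assms
proof (induction \<phi>)
  case (Var p)
  then show ?case by (simp add: closed_fm_def)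
next
  case Verum
  then show ?case by (auto intro!: exI[of _ "\<^bold>\<top>"] simp: level_def closed_fm_def)
next
  case (Neg \<phi>)
  then obtain \<psi> where "level n m \<psi>" "\<And>y. R n x y \<Longrightarrow> (\<phi> \<in> y \<longleftrightarrow> \<psi> \<in> y)" by (auto simp: closed_fm_def)
  then show ?case by (intro exI[of _ "\<^bold>\<not> \<psi>"]) (simp add: level_def closed_fm_def R_mcs(2))
next
  case (Conj \<phi>1 \<phi>2)
  then obtain \<psi>1 \<psi>2 where "level n m \<psi>1" "\<And>y. R n x y \<Longrightarrow> (\<phi>1 \<in> y \<longleftrightarrow> \<psi>1 \<in> y)"
    "level n m \<psi>2" "\<And>y. R n x y \<Longrightarrow> (\<phi>2 \<in> y \<longleftrightarrow> \<psi>2 \<in> y)" by (auto simp: closed_fm_def)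
  then show ?case by (intro exI[of _ "\<psi>1 \<^bold>\<and> \<psi>2"]) (simp add: level_def closed_fm_def R_mcs(2))
next
  case (Disj \<phi>1 \<phi>2)
  then obtain \<psi>1 \<psi>2 where "level n m \<psi>1" "\<And>y. R n x y \<Longrightarrow> (\<phi>1 \<in> y \<longleftrightarrow> \<psi>1 \<in> y)"
    "level n m \<psi>2" "\<And>y. R n x y \<Longrightarrow> (\<phi>2 \<in> y \<longleftrightarrow> \<psi>2 \<in> y)" by (auto simp: closed_fm_def)
  then show ?case by (intro exI[of _ "\<psi>1 \<^bold>\<or> \<psi>2"]) (simp add: level_def closed_fm_def R_mcs(2))
next
  case (Imp \<phi>1 \<phi>2)
  then obtain \<psi>1 \<psi>2 where "level n m \<psi>1" "\<And>y. R n x y \<Longrightarrow> (\<phi>1 \<in> y \<longleftrightarrow> \<psi>1 \<in> y)"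
    "level n m \<psi>2" "\<And>y. R n x y \<Longrightarrow> (\<phi>2 \<in> y \<longleftrightarrow> \<psi>2 \<in> y)" by (auto simp: closed_fm_def)
  then show ?case by (intro exI[of _ "\<psi>1 \<^bold>\<rightarrow> \<psi>2"]) (simp add: level_def closed_fm_def R_mcs(2))
next
  case (Box k \<phi>)
  show ?case
  proof (cases "k < n")
    case True
    then have "\<^bold>[k\<^bold>] \<phi> \<in> y \<longleftrightarrow> (if \<^bold>[k\<^bold>] \<phi> \<in> x then \<^bold>\<top> else \<^bold>\<bottom>) \<in> y" if "R n x y" for y
      using R_Box_iff[OF True that] R_mcs(2)[OF that] by simp
    moreover have "level n m (if \<^bold>[k\<^bold>] \<phi> \<in> x then \<^bold>\<top> else \<^bold>\<bottom>)" by (simp add: level_def closed_fm_def)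
    ultimately show ?thesis by blast
  next
    case False
    obtain \<psi> where \<psi>: "level n m \<psi>" "\<And>y. R n x y \<Longrightarrow> (\<phi> \<in> y \<longleftrightarrow> \<psi> \<in> y)"
      using Box by (auto simp: closed_fm_def)
    have "\<^bold>[k\<^bold>] \<phi> \<in> y \<longleftrightarrow> \<^bold>[k\<^bold>] \<psi> \<in> y" if y: "R n x y" for y
    proof -
      have "\<phi> \<in> z \<longleftrightarrow> \<psi> \<in> z" if "R k y z" for z
        using \<psi>(2) R_trans[OF y] R_antimono[OF _ that, of n] False by simp
      then show ?thesis using mcs_Box[OF R_mcs(2)[OF y]] by blast
    qed
    moreover have "level n m (\<^bold>[k\<^bold>] \<psi>)" using \<psi>(1) Box.prems False by (auto simp: level_def closed_fm_def)
    ultimately show ?thesis by blast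
  qed
qed

lemma closed_dot3:
  assumes "closed_fm A" "closed_fm B"
  shows "\<^bold>[n\<^bold>] (\<^bold>[n\<^bold>] A \<^bold>\<rightarrow> B) \<^bold>\<or> \<^bold>[n\<^bold>] (\<^bold>[n\<^bold>] B \<^bold>\<and> B \<^bold>\<rightarrow> A) \<in> L"
proof (subst L_iff_mcs, intro allI impI, rule ccontr)
  fix x assume x: "mcs x" and "\<^bold>[n\<^bold>] (\<^bold>[n\<^bold>] A \<^bold>\<rightarrow> B) \<^bold>\<or> \<^bold>[n\<^bold>] (\<^bold>[n\<^bold>] B \<^bold>\<and> B \<^bold>\<rightarrow> A) \<notin> x"
  then have n: "\<^bold>[n\<^bold>] (\<^bold>[n\<^bold>] A \<^bold>\<rightarrow> B) \<notin> x" "\<^bold>[n\<^bold>] (\<^bold>[n\<^bold>] B \<^bold>\<and> B \<^bold>\<rightarrow> A) \<notin> x" by auto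
  \<comment> \<open>Counterexamples to the two implications. They exclude each other at one point,
    and neither can lie n-beyond the other: the box in one refutes the negation in the
    other.\<close>
  define P Q where "P = \<^bold>[n\<^bold>] A \<^bold>\<and> \<^bold>\<not> B" and "Q = (\<^bold>[n\<^bold>] B \<^bold>\<and> B) \<^bold>\<and> \<^bold>\<not> A"
  obtain y z where y: "R n x y" "P \<in> y" and z: "R n x z" "Q \<in> z"
    using n unfolding mcs_Box[OF x] P_def Q_def by (metis mcs_Conj mcs_Imp mcs_Neg R_mcs(2))
  obtain m where m: "modalities P \<union> modalities Q \<subseteq> {..<m}"
    using finite_modalities finite_nat_iff_bounded by (metis finite_Un)
  have "closed_fm P" "closed_fm Q" using assms by (simp_all add: P_def Q_def closed_fm_def)
  \<comment> \<open>Comparison of worms covers modalities from \<open>n\<close> on only; below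
    \<open>n\<close> the boxes are constants among the successors of \<open>x\<close>.\<close>
  then obtain P' Q' where P': "level n m P'" "\<And>y. R n x y \<Longrightarrow> P \<in> y \<longleftrightarrow> P' \<in> y"
    and Q': "level n m Q'" "\<And>y. R n x y \<Longrightarrow> Q \<in> y \<longleftrightarrow> Q' \<in> y"
    using relative_level[of P m n x] relative_level[of Q m n x] m by auto
  obtain w where w: "R n x w" "P' \<in> w \<and> Q' \<in> w \<or> P' \<in> w \<and> \<^bold>\<langle>n\<^bold>\<rangle> Q' \<in> w \<or> Q' \<in> w \<and> \<^bold>\<langle>n\<^bold>\<rangle> P' \<in> w"
    using level_linear[OF P'(1) Q'(1) y(1) _ z(1)] P' Q' y z by auto
  have "mcs w" using w R_mcs by blast
  then have "P \<in> w \<and> Q \<in> w \<or> P \<in> w \<and> \<^bold>\<langle>n\<^bold>\<rangle> Q \<in> w \<or> Q \<in> w \<and> \<^bold>\<langle>n\<^bold>\<rangle> P \<in> w"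
    using w P'(2) Q'(2) R_trans[OF w(1)] unfolding mcs_Dia[OF \<open>mcs w\<close>] by metis
  moreover have "\<not> (P \<in> w \<and> \<^bold>\<langle>n\<^bold>\<rangle> Q \<in> w)"
    unfolding mcs_Dia[OF \<open>mcs w\<close>] P_def Q_def using R_Box R_mcs mcs_Conj mcs_Neg by blast
  moreover have "\<not> (Q \<in> w \<and> \<^bold>\<langle>n\<^bold>\<rangle> P \<in> w)"
  proof
    assume QP: "Q \<in> w \<and> \<^bold>\<langle>n\<^bold>\<rangle> P \<in> w"
    then obtain v where v: "R n w v" "P \<in> v" using mcs_Dia[OF \<open>mcs w\<close>] by blast
    have "\<^bold>[n\<^bold>] B \<in> w" using QP \<open>mcs w\<close> by (simp add: Q_def)
    then show False using v R_Box[OF v(1)] R_mcs(2)[OF v(1)] by (auto simp: P_def)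
  qed
  moreover have "\<not> (P \<in> w \<and> Q \<in> w)" using \<open>mcs w\<close> by (simp add: P_def Q_def)
  ultimately show False by blast
qed

end

section \<open>Embedding canonical worlds of GLP.3 into closed formulas\<close>

lemma theorems_of_mono:
  assumes "Ax \<subseteq> Ax'"
  shows "theorems_of Ax \<subseteq> theorems_of Ax'"
proof
  fix \<phi> assume "\<phi> \<in> theorems_of Ax"
  then show "\<phi> \<in> theorems_of Ax'"
  proof (induction rule: theorems_of.induct)
    case (Ax \<phi>)
    then show ?case using assms by (blast intro: theorems_of.Ax)
  qed (rule theorems_of.MP theorems_of.Nec; assumption)+
qed

lemma glp_logic_theorems_of: "GLP_axioms \<subseteq> Ax \<Longrightarrow> glp_logic (theorems_of Ax)"
  unfolding glp_logic_def GLP_def by (metis theorems_of_mono theorems_of.MP theorems_of.Nec)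

interpretation GLP: glp_logic GLP
  unfolding GLP_def by (rule glp_logic_theorems_of) simp

interpretation GLP3: glp_logic GLP3
  unfolding GLP3_def by (rule glp_logic_theorems_of) simp

section \<open>Linearity of the canonical frame of GLP.3\<close>

lemma GLP3_linear:
  assumes y: "GLP3.R n x y" and z: "GLP3.R n x z"
  shows "y = z \<or> GLP3.R n y z \<or> GLP3.R n z y"
proof (rule ccontr)
  assume a: "\<not> ?thesis"
  have m: "GLP3.mcs x" "GLP3.mcs y" "GLP3.mcs z" using assms GLP3.R_mcs by auto
  obtain A where A: "\<^bold>[n\<^bold>] A \<in> y" "A \<notin> z" using a m by (auto simp: GLP3.R_def)
  obtain B where B: "\<^bold>[n\<^bold>] B \<in> z" "B \<notin> y" using a m by (auto simp: GLP3.R_def)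
  obtain C where C: "C \<in> y" "C \<notin> z"
  proof (cases "y \<subseteq> z")
    case True
    then obtain C where "C \<in> z" "C \<notin> y" using a by auto
    then show ?thesis using that[of "\<^bold>\<not> C"] m by simp
  qed (use that in blast)
  \<comment> \<open>Weakening \<open>B\<close> by the negation of \<open>C\<close>, which separates
    \<open>y\<close> from \<open>z\<close>, makes it true at \<open>z\<close> itself as well as
    beyond, yet still false at \<open>y\<close>.\<close>
  let ?B = "B \<^bold>\<or> \<^bold>\<not> C"
  have "\<^bold>[n\<^bold>] (\<^bold>[n\<^bold>] A \<^bold>\<rightarrow> ?B) \<^bold>\<or> \<^bold>[n\<^bold>] (\<^bold>[n\<^bold>] ?B \<^bold>\<and> ?B \<^bold>\<rightarrow> A) \<in> x"
    by (rule GLP3.mcs_L[OF m(1)]) (auto simp: GLP3_def intro: theorems_of.Ax dot3_axioms.Dot3)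
  then consider "\<^bold>[n\<^bold>] A \<^bold>\<rightarrow> ?B \<in> y" | "\<^bold>[n\<^bold>] ?B \<^bold>\<and> ?B \<^bold>\<rightarrow> A \<in> z"
    using GLP3.R_Box[OF y] GLP3.R_Box[OF z] m(1) by auto
  then show False
  proof cases
    case 1
    then show False using A B C m(2) by simp
  next
    case 2
    have "?B \<in> w" if "GLP3.R n z w" for w
      using GLP3.R_Box[OF that B(1)] GLP3.R_mcs(2)[OF that] by simp
    then have "\<^bold>[n\<^bold>] ?B \<in> z" using GLP3.mcs_Box[OF m(3)] by blast
    then show False using 2 A C m(3) by simp
  qed
qed

lemma GLP3_first_successor:
  assumes "finite Z" "Z \<noteq> {}" "\<forall>z\<in>Z. GLP3.R n x z"
  shows "\<exists>y\<in>Z. \<forall>z\<in>Z. z = y \<or> GLP3.R n y z"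
  using assms
proof (induction rule: finite_ne_induct)
  case (insert a Z)
  then obtain y where y: "y \<in> Z" "\<forall>z\<in>Z. z = y \<or> GLP3.R n y z" by blast
  have "y = a \<or> GLP3.R n y a \<or> GLP3.R n a y" using insert.prems y(1) GLP3_linear by blast
  then show ?case
  proof (elim disjE)
    assume "GLP3.R n a y"
    then have "\<forall>z\<in>Z. GLP3.R n a z" using y(2) GLP3.R_trans[of n a y] by metis
    then show ?thesis by simp
  next
    assume "y = a"
    then show ?thesis using y by (intro bexI[of _ y]) auto
  next
    assume "GLP3.R n y a"
    then show ?thesis using y by (intro bexI[of _ y]) auto
  qed
qed simp

text \<open>A finite set \<open>W\<close> of worlds of the canonical model of GLP.3 together with closed formulas
  \<open>S y\<close> that describe, inside GLP, how the worlds \<open>y \<in> W\<close> see each other along the modalities from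
  \<open>n\<close> on; compare the arithmetical sentences in Solovay's proof.\<close>

locale solovay_family =
  fixes m :: nat and \<Phi> :: "fm set" and n :: nat and x :: "fm set"
    and W :: "fm set set" and S :: "fm set \<Rightarrow> fm"
  assumes root: "x \<in> W" and finite: "finite W"
    and mcs: "y \<in> W \<Longrightarrow> GLP3.mcs y"
    and closed: "y \<in> W \<Longrightarrow> closed_fm (S y)"
    and from_root: "y \<in> W \<Longrightarrow> y \<noteq> x \<Longrightarrow> GLP3.R n x y"
    and exhaustive: "GLP.mcs g \<Longrightarrow> (\<exists>h. GLP.R n g h \<and> S x \<in> h) \<or> (\<exists>y\<in>W. S y \<in> g)"
    and no_return: "y \<in> W \<Longrightarrow> S y \<in> g \<Longrightarrow> GLP.R n g h \<Longrightarrow> S x \<notin> h"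
    and disjoint: "GLP.mcs g \<Longrightarrow> y \<in> W \<Longrightarrow> z \<in> W \<Longrightarrow> S y \<in> g \<Longrightarrow> S z \<in> g \<Longrightarrow> y = z"
    and box: "y \<in> W \<Longrightarrow> n \<le> k \<Longrightarrow> \<^bold>[k\<^bold>] \<chi> \<in> y \<Longrightarrow> S y \<in> g \<Longrightarrow> GLP.R k g h \<Longrightarrow>
      \<exists>z\<in>W. \<chi> \<in> z \<and> S z \<in> h"
    and dia: "y \<in> W \<Longrightarrow> n \<le> k \<Longrightarrow> \<^bold>[k\<^bold>] \<chi> \<in> \<Phi> \<Longrightarrow> \<^bold>[k\<^bold>] \<chi> \<notin> y \<Longrightarrow> GLP.mcs g \<Longrightarrow> S y \<in> g \<Longrightarrow>
      \<exists>h. GLP.R k g h \<and> (\<exists>z\<in>W. \<chi> \<notin> z \<and> S z \<in> h)"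
    and possible: "GLP.R m g h \<Longrightarrow> \<exists>h'. GLP.R n g h' \<and> S x \<in> h'"

text \<open>Glues a family \<open>U\<close> for the modalities above \<open>n\<close> to a family
  \<open>W\<close> lying further along \<open>n\<close>. The formula \<open>F\<close> says that
  \<open>W\<close> is still ahead. The box conjunct selects places beyond which the root of
  \<open>U\<close> with \<open>W\<close> ahead never recurs; a step along \<open>n\<close> then
  either enters \<open>W\<close> or stays in \<open>U\<close> away from \<open>x\<close>. Both
  \<open>F\<close> and this conjunct are constant along higher modalities, so the properties of
  \<open>U\<close> there survive.\<close>

lemma solovay_family_extend:
  assumes T: "solovay_family m \<Phi> (Suc n) x U T"
    and fin: "finite W" and disj: "U \<inter> W = {}"
    and W: "\<And>z. z \<in> W \<Longrightarrow> GLP3.R n x z" and closed: "\<And>z. z \<in> W \<Longrightarrow> closed_fm (S z)" "closed_fm F"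
    and F_rigid: "\<And>g h. GLP.R (Suc n) g h \<Longrightarrow> F \<in> g \<longleftrightarrow> F \<in> h"
    and F_down: "\<And>g h. GLP.R n g h \<Longrightarrow> F \<in> h \<Longrightarrow> F \<in> g"
    and F_exh: "\<And>g. GLP.mcs g \<Longrightarrow> F \<notin> g \<Longrightarrow> \<exists>z\<in>W. S z \<in> g"
    and F_not: "\<And>z g. GLP.mcs g \<Longrightarrow> z \<in> W \<Longrightarrow> S z \<in> g \<Longrightarrow> F \<notin> g"
    and W_disj: "\<And>g y z. GLP.mcs g \<Longrightarrow> y \<in> W \<Longrightarrow> z \<in> W \<Longrightarrow> S y \<in> g \<Longrightarrow> S z \<in> g \<Longrightarrow> y = z"
    and W_box: "\<And>y k \<chi> g h. y \<in> W \<Longrightarrow> n \<le> k \<Longrightarrow> \<^bold>[k\<^bold>] \<chi> \<in> y \<Longrightarrow> S y \<in> g \<Longrightarrow> GLP.R k g h \<Longrightarrow>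
      \<exists>z\<in>W. \<chi> \<in> z \<and> S z \<in> h"
    and W_dia: "\<And>y k \<chi> g. y \<in> W \<Longrightarrow> n \<le> k \<Longrightarrow> \<^bold>[k\<^bold>] \<chi> \<in> \<Phi> \<Longrightarrow> \<^bold>[k\<^bold>] \<chi> \<notin> y \<Longrightarrow> GLP.mcs g \<Longrightarrow> S y \<in> g \<Longrightarrow>
      \<exists>h. GLP.R k g h \<and> (\<exists>z\<in>W. \<chi> \<notin> z \<and> S z \<in> h)"
    and F_dia: "\<And>\<chi> g. \<^bold>[n\<^bold>] \<chi> \<in> \<Phi> \<Longrightarrow> \<^bold>[n\<^bold>] \<chi> \<notin> x \<Longrightarrow> GLP.mcs g \<Longrightarrow> F \<in> g \<Longrightarrow>
      \<exists>h. GLP.R n g h \<and> (\<exists>z\<in>W. \<chi> \<notin> z \<and> S z \<in> h)"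
    and F_possible: "\<And>g h. GLP.R m g h \<Longrightarrow> F \<in> g"
  defines "S' \<equiv> \<lambda>y. if y \<in> U then T y \<^bold>\<and> F \<^bold>\<and> \<^bold>[n\<^bold>] \<^bold>\<not> (T x \<^bold>\<and> F) else S y"
  shows "solovay_family m \<Phi> n x (U \<union> W) S'"
proof -
  interpret T: solovay_family m \<Phi> "Suc n" x U T by (rule T)
  define q where "q g \<longleftrightarrow> T x \<in> g \<and> F \<in> g" for g
  define least where "least g \<longleftrightarrow> (\<forall>h. GLP.R n g h \<longrightarrow> \<not> q h)" for g
  have SU: "S' y \<in> g \<longleftrightarrow> T y \<in> g \<and> F \<in> g \<and> least g" if "y \<in> U" "GLP.mcs g" for y g
  proof -
    have "\<^bold>[n\<^bold>] \<^bold>\<not> (T x \<^bold>\<and> F) \<in> g \<longleftrightarrow> least g"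
      unfolding least_def q_def GLP.mcs_Box[OF that(2)] using GLP.mcs_Neg GLP.mcs_Conj GLP.R_mcs(2) by metis
    then show ?thesis using that by (simp add: S'_def)
  qed
  have SW: "S' z = S z" if "z \<in> W" for z using that disj by (auto simp: S'_def)
  have Loeb: "\<exists>h. GLP.R n g h \<and> S' x \<in> h" if "GLP.R n g h" "q h" for g h
  proof -
    have "T x \<^bold>\<and> F \<in> h" using that GLP.R_mcs(2) by (simp add: q_def)
    from GLP.Loeb_Dia[OF that(1) this] obtain z where z: "GLP.R n g z" "T x \<^bold>\<and> F \<in> z"
      "\<And>w. GLP.R n z w \<Longrightarrow> T x \<^bold>\<and> F \<notin> w" by blast
    then have "least z" unfolding least_def q_def using GLP.mcs_Conj GLP.R_mcs(2) by blast
    then show ?thesis using z SU[OF T.root] GLP.R_mcs(2) by (metis GLP.mcs_Conj)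
  qed
  have R_down: "GLP.R n g h" "GLP.R (Suc n) g h" if "GLP.R k g h" "n < k" for g h k
    using that GLP.R_antimono[of n k] GLP.R_antimono[of "Suc n" k] by auto
  \<comment> \<open>Failing exhaustiveness would yield an (n+1)-successor with \<open>T x\<close>;
    \<open>F\<close> persists there by rigidity, against leastness.\<close>
  have T_exh: "\<exists>y\<in>U. T y \<in> g" if g: "GLP.mcs g" "F \<in> g" "least g" for g
  proof (rule ccontr)
    assume "\<not> ?thesis"
    then obtain h where h: "GLP.R (Suc n) g h" "T x \<in> h" using T.exhaustive[OF g(1)] by blast
    then have "q h" using F_rigid g(2) by (simp add: q_def)
    then show False using g(3) GLP.R_antimono_Suc[OF h(1)] by (auto simp: least_def)
  qed
  have least_same: "least h" if "GLP.R k g h" "least g" "n < k" for g h k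
    using that GLP.R_succ_iff[of n k g h] by (simp add: least_def)
  have least_trans: "least h" if "GLP.R n g h" "least g" for g h
    using that GLP.R_trans unfolding least_def by blast
  have Box_x: "\<^bold>[n\<^bold>] \<chi> \<in> x \<longleftrightarrow> \<^bold>[n\<^bold>] \<chi> \<in> y" if "y \<in> U" for y \<chi>
    using GLP3.R_Box_iff[of n "Suc n" x y \<chi>] T.from_root[OF that] by (cases "y = x") auto
  show ?thesis
  proof
    show "x \<in> U \<union> W" "finite (U \<union> W)" using T.root T.finite fin by auto
  next
    fix y assume y: "y \<in> U \<union> W"
    show "GLP3.mcs y" using y T.mcs GLP3.R_mcs(2)[OF W] by blast
    show "closed_fm (S' y)"
      using y closed T.closed T.root by (auto simp: S'_def closed_fm_def)
    show "GLP3.R n x y" if "y \<noteq> x" using y W T.from_root[OF _ that] GLP3.R_antimono_Suc by blast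
  next
    fix g assume g: "GLP.mcs g"
    show "(\<exists>h. GLP.R n g h \<and> S' x \<in> h) \<or> (\<exists>y\<in>U \<union> W. S' y \<in> g)"
    proof (cases "least g")
      case False
      then show ?thesis using Loeb by (auto simp: least_def)
    next
      case True
      show ?thesis
      proof (cases "F \<in> g")
        case False
        then show ?thesis using F_exh[OF g] SW by (metis UnI2)
      next
        case F: True
        then show ?thesis using T_exh[OF g F True] SU g True by blast
      qed
    qed
  next
    fix y g h assume a: "y \<in> U \<union> W" "S' y \<in> g" "GLP.R n g h"
    note m = GLP.R_mcs[OF a(3)]
    show "S' x \<notin> h"
    proof (cases "y \<in> U")
      case True
      then have "\<not> q h" using a SU[OF True m(1)] by (auto simp: least_def)
      then show ?thesis using SU[OF T.root m(2)] by (auto simp: q_def)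
    next
      case False
      then have "F \<notin> g" using a SW F_not[OF m(1)] by auto
      then show ?thesis using F_down[OF a(3)] SU[OF T.root m(2)] by blast
    qed
  next
    fix g y z assume a: "GLP.mcs g" "y \<in> U \<union> W" "z \<in> U \<union> W" "S' y \<in> g" "S' z \<in> g"
    have U: "T v \<in> g \<and> F \<in> g" if "v \<in> U" "S' v \<in> g" for v using SU[OF that(1) a(1)] that(2) by blast
    have W': "S v \<in> g \<and> F \<notin> g" if "v \<in> W" "S' v \<in> g" for v using SW F_not[OF a(1) that(1)] that by auto
    show "y = z"
    proof (cases "y \<in> U \<longleftrightarrow> z \<in> U")
      case True
      then show ?thesis
        using a U[of y] U[of z] W'[of y] W'[of z] T.disjoint[OF a(1), of y z] W_disj[OF a(1), of y z] by blast
    next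
      case False
      then show ?thesis using a U[of y] U[of z] W'[of y] W'[of z] by blast
    qed
  next
    fix y k \<chi> g h
    assume y: "y \<in> U \<union> W" and k: "n \<le> k" and \<chi>: "\<^bold>[k\<^bold>] \<chi> \<in> y" and S: "S' y \<in> g" and R: "GLP.R k g h"
    note m = GLP.R_mcs[OF R]
    show "\<exists>z\<in>U \<union> W. \<chi> \<in> z \<and> S' z \<in> h"
    proof (cases "y \<in> U")
      case False
      then show ?thesis using W_box[of y k \<chi> g h] y k \<chi> S R SW by (metis Un_iff)
    next
      case yU: True
      then have g: "T y \<in> g" "F \<in> g" "least g" using SU[OF _ m(1)] S by auto
      show ?thesis
      proof (cases "n < k")
        case True
        then obtain z where z: "z \<in> U" "\<chi> \<in> z" "T z \<in> h" using T.box[OF yU _ \<chi> g(1) R] by auto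
        have "S' z \<in> h"
          using SU[OF z(1) m(2)] z(3) F_rigid[OF R_down(2)[OF R True]] g least_same[OF R g(3) True] by blast
        then show ?thesis using z by blast
      next
        case False
        then have [simp]: "k = n" using k by simp
        have x\<chi>: "\<^bold>[n\<^bold>] \<chi> \<in> x" using Box_x[OF yU] \<chi> by simp
        have h: "\<not> q h" "least h" using g(3) R least_trans[of g h] by (auto simp: least_def)
        show ?thesis
        proof (cases "F \<in> h")
          case False
          then obtain z where "z \<in> W" "S z \<in> h" using F_exh[OF m(2)] by blast
          then show ?thesis using GLP3.R_Box[OF W x\<chi>] SW by (metis UnI2)
        next
          case True
          then obtain z where z: "z \<in> U" "T z \<in> h" using T_exh[OF m(2) True h(2)] by blast
          \<comment> \<open>The root cannot recur, and any other world of \<open>U\<close> is an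
            (n+1)-successor of \<open>x\<close>, hence an n-successor, where \<open>\<chi>\<close>
            holds.\<close>
          then have "z \<noteq> x" using h(1) True by (auto simp: q_def)
          then have "\<chi> \<in> z" using T.from_root[OF z(1)] GLP3.R_antimono_Suc GLP3.R_Box x\<chi> by blast
          then show ?thesis using SU[OF z(1) m(2)] z True h(2) by blast
        qed
      qed
    qed
  next
    fix y k \<chi> g
    assume y: "y \<in> U \<union> W" and k: "n \<le> k" and \<chi>: "\<^bold>[k\<^bold>] \<chi> \<in> \<Phi>" "\<^bold>[k\<^bold>] \<chi> \<notin> y" and m: "GLP.mcs g"
      and S: "S' y \<in> g"
    show "\<exists>h. GLP.R k g h \<and> (\<exists>z\<in>U \<union> W. \<chi> \<notin> z \<and> S' z \<in> h)"
    proof (cases "y \<in> U")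
      case False
      then show ?thesis using W_dia[of y k \<chi> g] y k \<chi> S m SW by (metis Un_iff)
    next
      case yU: True
      then have g: "T y \<in> g" "F \<in> g" "least g" using SU[OF _ m] S by auto
      show ?thesis
      proof (cases "n < k")
        case True
        then obtain h z where h: "GLP.R k g h" and z: "z \<in> U" "\<chi> \<notin> z" "T z \<in> h"
          using T.dia[OF yU _ \<chi> m g(1)] by auto
        have "S' z \<in> h"
          using SU[OF z(1) GLP.R_mcs(2)[OF h]] z(3) F_rigid[OF R_down(2)[OF h True]] g least_same[OF h g(3) True]
          by blast
        then show ?thesis using h z by blast
      next
        case False
        then have [simp]: "k = n" using k by simp
        show ?thesis using F_dia[of \<chi> g] \<chi> Box_x[OF yU] m g(2) SW by (metis UnI2 \<open>k = n\<close>)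
      qed
    qed
  next
    fix g h assume R: "GLP.R m g h"
    obtain h' where h': "GLP.R (Suc n) g h'" "T x \<in> h'" using T.possible[OF R] by blast
    then have "q h'" using F_possible[OF R] F_rigid by (auto simp: q_def)
    then show "\<exists>h'. GLP.R n g h' \<and> S' x \<in> h'" using Loeb GLP.R_antimono_Suc[OF h'(1)] by blast
  qed
qed

text \<open>No box of \<open>\<Phi>\<close> has a modality from \<open>m\<close> on, so one world
  suffices. It is described by a dead end for \<open>m\<close>, which exists beyond every world with
  an m-successor, by Loeb's axiom.\<close>

lemma solovay_family_base:
  assumes "GLP3.mcs x" "\<And>k \<chi>. \<^bold>[k\<^bold>] \<chi> \<in> \<Phi> \<Longrightarrow> k < m"
  shows "solovay_family m \<Phi> m x {x} (\<lambda>_. \<^bold>[m\<^bold>] \<^bold>\<bottom>)"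
proof -
  have dead: "False" if "\<^bold>[m\<^bold>] \<^bold>\<bottom> \<in> g" "GLP.R k g h" "m \<le> k" for g h k
    using that GLP.R_antimono[OF that(3,2)] GLP.R_Box[of m g h "\<^bold>\<bottom>"] GLP.R_mcs[OF that(2)] by simp
  have Loeb: "\<exists>h. GLP.R m g h \<and> \<^bold>[m\<^bold>] \<^bold>\<bottom> \<in> h" if R: "GLP.R m g h" for g h
  proof -
    obtain h' where "GLP.R m g h'" "\<And>w. \<not> GLP.R m h' w"
      using GLP.Loeb_Dia[OF R, of "\<^bold>\<top>"] GLP.R_mcs(2) GLP.mcs_Verum R by blast
    then show ?thesis using GLP.mcs_Box GLP.R_mcs(2) by blast
  qed
  show ?thesis
  proof
    fix g assume "GLP.mcs g"
    then show "(\<exists>h. GLP.R m g h \<and> \<^bold>[m\<^bold>] \<^bold>\<bottom> \<in> h) \<or> (\<exists>y\<in>{x}. \<^bold>[m\<^bold>] \<^bold>\<bottom> \<in> g)"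
      using Loeb GLP.mcs_Box by blast
  next
    fix g h assume "GLP.R m g h"
    then show "\<exists>h'. GLP.R m g h' \<and> \<^bold>[m\<^bold>] \<^bold>\<bottom> \<in> h'" by (rule Loeb)
  next
    fix y k \<chi> g assume "m \<le> k" "\<^bold>[k\<^bold>] \<chi> \<in> \<Phi>"
    then show "\<exists>h. GLP.R k g h \<and> (\<exists>z\<in>{x}. \<chi> \<notin> z \<and> \<^bold>[m\<^bold>] \<^bold>\<bottom> \<in> h)" using assms(2) by fastforce
  next
    fix y g h assume "\<^bold>[m\<^bold>] \<^bold>\<bottom> \<in> g" "GLP.R m g h"
    then show "\<^bold>[m\<^bold>] \<^bold>\<bottom> \<notin> h" using dead by blast
  next
    fix y k \<chi> g h assume "\<^bold>[m\<^bold>] \<^bold>\<bottom> \<in> g" "GLP.R k g h" "m \<le> k"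
    then show "\<exists>z\<in>{x}. \<chi> \<in> z \<and> \<^bold>[m\<^bold>] \<^bold>\<bottom> \<in> h" using dead by blast
  qed (use assms in \<open>auto simp: closed_fm_def\<close>)
qed

text \<open>Downward induction on the modality; inside a level, induction on the number of n-boxes
  of \<open>\<Phi>\<close> refuted at \<open>x\<close>. Linearity allows all of them to be witnessed
  through one successor \<open>x'\<close>, whose own family has fewer boxes left to refute.\<close>

lemma solovay_family_exists:
  assumes "n \<le> m" and fin: "finite \<Phi>" and \<Phi>: "\<And>k \<chi>. \<^bold>[k\<^bold>] \<chi> \<in> \<Phi> \<Longrightarrow> k < m" and "GLP3.mcs x"
  shows "\<exists>W S. solovay_family m \<Phi> n x W S"
  using assms(1,4)
proof (induction arbitrary: x rule: inc_induct)
  case base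
  then show ?case using solovay_family_base \<Phi> by blast
next
  case (step n)
  note level_IH = step.IH
  define refuted where "refuted x = {\<chi>. \<^bold>[n\<^bold>] \<chi> \<in> \<Phi> \<and> \<^bold>[n\<^bold>] \<chi> \<notin> x}" for x
  have fin_refuted: "finite (refuted x)" for x
  proof (rule finite_subset)
    show "refuted x \<subseteq> the_inv_into UNIV (Box n) ` \<Phi>"
      unfolding refuted_def by (force simp: the_inv_into_f_f inj_def image_iff)
  qed (use fin in simp)
  from step.prems show ?case
  proof (induction "card (refuted x)" arbitrary: x rule: less_induct)
    case less
    obtain U T where "solovay_family m \<Phi> (Suc n) x U T" using level_IH less.prems by blast
    then interpret T: solovay_family m \<Phi> "Suc n" x U T .
    show ?case
    proof (cases "refuted x = {}")
      case True
      \<comment> \<open>No n-box has to be refuted, so nothing needs to lie ahead: \<open>W\<close>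
        is empty and \<open>F\<close> is true.\<close>
      have "solovay_family m \<Phi> n x (U \<union> {})
          (\<lambda>y. if y \<in> U then T y \<^bold>\<and> \<^bold>\<top> \<^bold>\<and> \<^bold>[n\<^bold>] \<^bold>\<not> (T x \<^bold>\<and> \<^bold>\<top>) else undefined y)"
        by (rule solovay_family_extend[OF T.solovay_family_axioms])
          (use True in \<open>auto simp: closed_fm_def refuted_def GLP.R_mcs\<close>)
      then show ?thesis by blast
    next
      case False
      \<comment> \<open>Loeb's axiom supplies a last counterexample, so that its box becomes true
        and the number of refuted boxes drops.\<close>
      have "\<exists>y. GLP3.R n x y \<and> \<chi> \<notin> y \<and> \<^bold>[n\<^bold>] \<chi> \<in> y" if "\<chi> \<in> refuted x" for \<chi>
        using that GLP3.Loeb_Box[OF less.prems, of n \<chi>] by (auto simp: refuted_def)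
      then obtain f where f: "\<And>\<chi>. \<chi> \<in> refuted x \<Longrightarrow> GLP3.R n x (f \<chi>) \<and> \<chi> \<notin> f \<chi> \<and> \<^bold>[n\<^bold>] \<chi> \<in> f \<chi>" by metis
      obtain \<chi>0 where \<chi>0: "\<chi>0 \<in> refuted x"
        and first: "\<And>\<chi>. \<chi> \<in> refuted x \<Longrightarrow> f \<chi> = f \<chi>0 \<or> GLP3.R n (f \<chi>0) (f \<chi>)"
      proof -
        have "\<exists>y\<in>f ` refuted x. \<forall>z\<in>f ` refuted x. z = y \<or> GLP3.R n y z"
          using f fin_refuted False by (intro GLP3_first_successor[of _ n x]) auto
        then show ?thesis using that by blast
      qed
      define x' where "x' = f \<chi>0"
      have x': "GLP3.R n x x'" "\<^bold>[n\<^bold>] \<chi>0 \<in> x'" and mx': "GLP3.mcs x'"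
        using f[OF \<chi>0] GLP3.R_mcs(2) by (auto simp: x'_def)
      have "refuted x' \<subset> refuted x"
        using x' \<chi>0 GLP3.R_Box4[OF x'(1)] by (auto simp: refuted_def)
      then have "card (refuted x') < card (refuted x)" by (rule psubset_card_mono[OF fin_refuted])
      then obtain W S where "solovay_family m \<Phi> n x' W S" using less.hyps mx' by blast
      then interpret W: solovay_family m \<Phi> n x' W S .
      let ?F = "\<^bold>\<langle>n\<^bold>\<rangle> S x'"
      have F: "?F \<in> g \<longleftrightarrow> (\<exists>h. GLP.R n g h \<and> S x' \<in> h)" if "GLP.mcs g" for g
        by (rule GLP.mcs_Dia[OF that])
      have W: "GLP3.R n x z" if "z \<in> W" for z
        using W.from_root[OF that] x'(1) GLP3.R_trans by (cases "z = x'") auto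
      \<comment> \<open>The box of \<open>\<chi>0\<close> holds throughout \<open>W\<close> and
        fails throughout \<open>U\<close>, which keeps the two sets of worlds disjoint.\<close>
      have \<chi>0_W: "\<^bold>[n\<^bold>] \<chi>0 \<in> z" if "z \<in> W" for z
        using W.from_root[OF that] x'(2) GLP3.R_Box4 by (cases "z = x'") auto
      have \<chi>0_U: "\<^bold>[n\<^bold>] \<chi>0 \<notin> y" if "y \<in> U" for y
        using T.from_root[OF that] \<chi>0 GLP3.R_Box_iff[of n "Suc n" x y \<chi>0] by (cases "y = x") (auto simp: refuted_def)
      have "solovay_family m \<Phi> n x (U \<union> W)
          (\<lambda>y. if y \<in> U then T y \<^bold>\<and> ?F \<^bold>\<and> \<^bold>[n\<^bold>] \<^bold>\<not> (T x \<^bold>\<and> ?F) else S y)"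
      proof (rule solovay_family_extend[OF T.solovay_family_axioms W.finite _ W W.closed])
        show "U \<inter> W = {}" using \<chi>0_W \<chi>0_U by blast
        show "closed_fm ?F" using W.closed[OF W.root] by (simp add: closed_fm_def)
        show "?F \<in> g \<longleftrightarrow> ?F \<in> h" if "GLP.R (Suc n) g h" for g h using GLP.Dia_mcs_succ[OF _ that] by blast
        show "?F \<in> g" if R: "GLP.R n g h" and Fh: "?F \<in> h" for g h
        proof -
          obtain w where w: "GLP.R n h w" "S x' \<in> w" using F[OF GLP.R_mcs(2)[OF R]] Fh by blast
          show ?thesis
            unfolding F[OF GLP.R_mcs(1)[OF R]] using GLP.R_trans[OF R w(1)] w(2) by blast
        qed
        show "\<exists>z\<in>W. S z \<in> g" if g: "GLP.mcs g" "?F \<notin> g" for g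
          using W.exhaustive[OF g(1)] g(2) unfolding F[OF g(1)] by blast
        show "?F \<notin> g" if g: "GLP.mcs g" and z: "z \<in> W" "S z \<in> g" for z g
          using W.no_return[OF z] unfolding F[OF g] by blast
        show "?F \<in> g" if R: "GLP.R m g h" for g h
          using W.possible[OF R] unfolding F[OF GLP.R_mcs(1)[OF R]] .
        show "\<exists>h. GLP.R n g h \<and> (\<exists>z\<in>W. \<chi> \<notin> z \<and> S z \<in> h)"
          if \<chi>: "\<^bold>[n\<^bold>] \<chi> \<in> \<Phi>" "\<^bold>[n\<^bold>] \<chi> \<notin> x" and g: "GLP.mcs g" "?F \<in> g" for \<chi> g
        proof -
          obtain h where h: "GLP.R n g h" "S x' \<in> h" using g(2) unfolding F[OF g(1)] by blast
          have r: "\<chi> \<in> refuted x" using \<chi> by (simp add: refuted_def)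
          show ?thesis
          proof (cases "\<chi> \<in> x'")
            case False
            then show ?thesis using h W.root by blast
          next
            \<comment> \<open>The counterexample chosen for \<open>\<chi>\<close> comes after
              \<open>x'\<close>, because \<open>x'\<close> is first; hence \<open>x'\<close> still
              refutes the box, and the family \<open>W\<close> realises this.\<close>
            case True
            then have "GLP3.R n x' (f \<chi>)" using first[OF r] f[OF r] by (auto simp: x'_def)
            then have "\<^bold>[n\<^bold>] \<chi> \<notin> x'" using f[OF r] GLP3.R_Box by blast
            then obtain h' z where "GLP.R n h h'" "z \<in> W" "\<chi> \<notin> z" "S z \<in> h'"
              using W.dia[OF W.root order_refl \<chi>(1) _ GLP.R_mcs(2)[OF h(1)] h(2)] by blast
            then show ?thesis using GLP.R_trans[OF h(1)] by blast
          qed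
        qed
      qed (assumption | rule W.disjoint W.box W.dia)+
      then show ?thesis by blast
    qed
  qed
qed

section \<open>Truth lemma and refuting substitution\<close>

primrec boxed_subformulas :: "fm \<Rightarrow> fm set" where
  "boxed_subformulas (Var p) = {}"
| "boxed_subformulas \<^bold>\<top> = {}"
| "boxed_subformulas (\<^bold>\<not> \<phi>) = boxed_subformulas \<phi>"
| "boxed_subformulas (\<phi> \<^bold>\<and> \<psi>) = boxed_subformulas \<phi> \<union> boxed_subformulas \<psi>"
| "boxed_subformulas (\<phi> \<^bold>\<or> \<psi>) = boxed_subformulas \<phi> \<union> boxed_subformulas \<psi>"
| "boxed_subformulas (\<phi> \<^bold>\<rightarrow> \<psi>) = boxed_subformulas \<phi> \<union> boxed_subformulas \<psi>"
| "boxed_subformulas (\<^bold>[n\<^bold>] \<phi>) = insert (\<^bold>[n\<^bold>] \<phi>) (boxed_subformulas \<phi>)"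

lemma finite_boxed_subformulas: "finite (boxed_subformulas \<phi>)"
  by (induction \<phi>) auto

lemma boxed_subformulas_modalities: "\<^bold>[k\<^bold>] \<chi> \<in> boxed_subformulas \<phi> \<Longrightarrow> k \<in> modalities \<phi>"
  by (induction \<phi>) auto

lemma finite_disjunction:
  assumes "finite A" "\<forall>\<phi>\<in>A. closed_fm \<phi>"
  shows "\<exists>\<delta>. closed_fm \<delta> \<and> (\<forall>g. GLP.mcs g \<longrightarrow> (\<delta> \<in> g \<longleftrightarrow> (\<exists>\<phi>\<in>A. \<phi> \<in> g)))"
  using assms
proof (induction rule: finite_induct)
  case empty
  then show ?case by (intro exI[of _ "\<^bold>\<bottom>"]) (simp add: closed_fm_def)
next
  case (insert \<phi> A)
  then obtain \<delta> where "closed_fm \<delta>" "\<forall>g. GLP.mcs g \<longrightarrow> (\<delta> \<in> g \<longleftrightarrow> (\<exists>\<phi>\<in>A. \<phi> \<in> g))" by auto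
  then show ?case using insert.prems by (intro exI[of _ "\<phi> \<^bold>\<or> \<delta>"]) (simp add: closed_fm_def)
qed

text \<open>Each variable is interpreted by the disjunction of the descriptions of the worlds that
  contain it. The box and diamond clauses of the family then act as back and forth
  conditions.\<close>

lemma solovay_truth:
  assumes "solovay_family m \<Phi> 0 x W S"
    and \<sigma>: "\<And>p g. GLP.mcs g \<Longrightarrow> \<sigma> p \<in> g \<longleftrightarrow> (\<exists>z\<in>W. Var p \<in> z \<and> S z \<in> g)"
    and "boxed_subformulas \<chi> \<subseteq> \<Phi>" "y \<in> W" "GLP.mcs g" "S y \<in> g"
  shows "subst \<sigma> \<chi> \<in> g \<longleftrightarrow> \<chi> \<in> y"
proof -
  interpret solovay_family m \<Phi> 0 x W S by (rule assms(1))
  show ?thesis using assms(3-)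
  proof (induction \<chi> arbitrary: y g)
    case (Var p)
    then have "subst \<sigma> (Var p) \<in> g \<longleftrightarrow> (\<exists>z\<in>W. Var p \<in> z \<and> S z \<in> g)" using \<sigma> by simp
    also have "\<dots> \<longleftrightarrow> Var p \<in> y" using disjoint[OF Var.prems(3,2)] Var.prems(2,4) by metis
    finally show ?case .
  next
    case (Box k \<chi>)
    show ?case
    proof
      assume "\<^bold>[k\<^bold>] \<chi> \<in> y"
      then have "subst \<sigma> \<chi> \<in> h" if "GLP.R k g h" for h
        using box[OF Box.prems(2) _ _ Box.prems(4) that] Box.IH GLP.R_mcs(2)[OF that] Box.prems(1) by auto
      then show "subst \<sigma> (\<^bold>[k\<^bold>] \<chi>) \<in> g" using GLP.mcs_Box[OF Box.prems(3)] by simp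
    next
      assume s: "subst \<sigma> (\<^bold>[k\<^bold>] \<chi>) \<in> g"
      show "\<^bold>[k\<^bold>] \<chi> \<in> y"
      proof (rule ccontr)
        assume "\<^bold>[k\<^bold>] \<chi> \<notin> y"
        then obtain h z where h: "GLP.R k g h" "z \<in> W" "\<chi> \<notin> z" "S z \<in> h"
          using dia[OF Box.prems(2) _ _ _ Box.prems(3,4), of k \<chi>] Box.prems(1) by auto
        then have "subst \<sigma> \<chi> \<notin> h" using Box.IH[OF _ h(2) GLP.R_mcs(2)[OF h(1)] h(4)] Box.prems(1) by simp
        then show False using GLP.R_Box[OF h(1)] s by simp
      qed
    qed
  qed (use mcs in auto)
qed

text \<open>For the root world \<open>x\<close> of a refutation, \<open>S x\<close> refutes the substitution instance, and \<open>S x\<close> is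
  possible as soon as \<open>\<^bold>\<langle>m\<^bold>\<rangle> \<^bold>\<top>\<close> is true.\<close>

lemma refuting_substitution:
  assumes "\<phi> \<notin> GLP3"
  shows "\<exists>\<sigma> m. (\<forall>p. closed_fm (\<sigma> p)) \<and> \<^bold>[0\<^bold>] subst \<sigma> \<phi> \<^bold>\<rightarrow> \<^bold>[m\<^bold>] \<^bold>\<bottom> \<in> GLP"
proof -
  obtain x where x: "GLP3.mcs x" "\<phi> \<notin> x" using assms GLP3.L_iff_mcs by blast
  obtain m where m: "modalities \<phi> \<subseteq> {..<m}" using finite_modalities finite_nat_iff_bounded by metis
  obtain W S where WS: "solovay_family m (boxed_subformulas \<phi>) 0 x W S"
    using solovay_family_exists[of 0 m "boxed_subformulas \<phi>" x] finite_boxed_subformulas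
      boxed_subformulas_modalities m x(1) by blast
  interpret solovay_family m "boxed_subformulas \<phi>" 0 x W S by (rule WS)
  have "\<exists>\<delta>. closed_fm \<delta> \<and> (\<forall>g. GLP.mcs g \<longrightarrow> (\<delta> \<in> g \<longleftrightarrow> (\<exists>z\<in>W. Var p \<in> z \<and> S z \<in> g)))" for p
  proof -
    have "finite (S ` {z \<in> W. Var p \<in> z})" "\<forall>\<psi>\<in>S ` {z \<in> W. Var p \<in> z}. closed_fm \<psi>"
      using finite closed by auto
    moreover have "(\<exists>\<psi>\<in>S ` {z \<in> W. Var p \<in> z}. \<psi> \<in> g) \<longleftrightarrow> (\<exists>z\<in>W. Var p \<in> z \<and> S z \<in> g)" for g by auto
    ultimately show ?thesis using finite_disjunction[of "S ` {z \<in> W. Var p \<in> z}"] by simp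
  qed
  then obtain \<sigma> where \<sigma>: "\<And>p. closed_fm (\<sigma> p)"
    "\<And>p g. GLP.mcs g \<Longrightarrow> \<sigma> p \<in> g \<longleftrightarrow> (\<exists>z\<in>W. Var p \<in> z \<and> S z \<in> g)" by metis
  have "\<^bold>[0\<^bold>] subst \<sigma> \<phi> \<^bold>\<rightarrow> \<^bold>[m\<^bold>] \<^bold>\<bottom> \<in> g" if g: "GLP.mcs g" for g
  proof (rule ccontr)
    assume "\<^bold>[0\<^bold>] subst \<sigma> \<phi> \<^bold>\<rightarrow> \<^bold>[m\<^bold>] \<^bold>\<bottom> \<notin> g"
    then have box: "\<^bold>[0\<^bold>] subst \<sigma> \<phi> \<in> g" and "\<^bold>[m\<^bold>] \<^bold>\<bottom> \<notin> g" using g by auto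
    then obtain h where "GLP.R m g h" using GLP.mcs_Box[OF g] by blast
    then obtain h' where h': "GLP.R 0 g h'" "S x \<in> h'" using possible by blast
    have "subst \<sigma> \<phi> \<notin> h'"
      using solovay_truth[OF WS \<sigma>(2) order_refl root GLP.R_mcs(2)[OF h'(1)] h'(2)] x(2) by blast
    then show False using GLP.R_Box[OF h'(1) box] by blast
  qed
  then show ?thesis using \<sigma>(1) GLP.L_iff_mcs by blast
qed

section \<open>The equivalences\<close>

lemma subst_cong: "(\<And>p. p \<in> vars \<phi> \<Longrightarrow> \<sigma> p = \<tau> p) \<Longrightarrow> subst \<sigma> \<phi> = subst \<tau> \<phi>"
  by (induction \<phi>) auto

lemma subst_subst: "subst \<sigma> (subst \<tau> \<phi>) = subst (\<lambda>p. subst \<sigma> (\<tau> p)) \<phi>"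
  by (induction \<phi>) auto

lemma closed_subst: "\<forall>p. closed_fm (\<sigma> p) \<Longrightarrow> closed_fm (subst \<sigma> \<phi>)"
  by (induction \<phi>) (auto simp: closed_fm_def)

lemma closed_substitutions_eq:
  "closed_substitutions \<phi> = {subst \<sigma> \<phi> | \<sigma>. \<forall>p. closed_fm (\<sigma> p)}"
proof -
  have "\<exists>\<tau>. subst \<sigma> \<phi> = subst \<tau> \<phi> \<and> (\<forall>p. closed_fm (\<tau> p))" if "\<forall>p\<in>vars \<phi>. closed_fm (\<sigma> p)" for \<sigma>
    \<comment> \<open>Variables outside \<open>\<phi>\<close> receive the default value verum, which
      makes the substitution closed everywhere.\<close>
    using that by (intro exI[of _ "\<lambda>p. if p \<in> vars \<phi> then \<sigma> p else \<^bold>\<top>"])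
      (auto intro!: subst_cong simp: closed_fm_def)
  then show ?thesis unfolding closed_substitutions_def by auto
qed

text \<open>Pulling the valuation back along the substitution shows that instances of tautologies
  are tautologies.\<close>

lemma prop_eval_subst: "prop_eval V (subst \<sigma> \<phi>) \<longleftrightarrow> prop_eval (\<lambda>\<psi>. prop_eval V (subst \<sigma> \<psi>)) \<phi>"
  by (induction \<phi>) auto

lemma subst_GLP_axioms: "\<phi> \<in> GLP_axioms \<Longrightarrow> subst \<sigma> \<phi> \<in> GLP_axioms"
proof (induction rule: GLP_axioms.induct)
  case (Taut \<phi>)
  then have "tautology (subst \<sigma> \<phi>)" unfolding tautology_def by (subst prop_eval_subst) blast
  then show ?case by (rule GLP_axioms.Taut)
next
  case (Mono n \<phi>)
  show ?case using GLP_axioms.Mono[of n "subst \<sigma> \<phi>"] by simp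
next
  case (Dia_Box n \<phi>)
  show ?case using GLP_axioms.Dia_Box[of n "subst \<sigma> \<phi>"] by simp
qed (simp_all add: GLP_axioms.K GLP_axioms.Loeb)

lemma subst_GLP: "\<phi> \<in> GLP \<Longrightarrow> subst \<sigma> \<phi> \<in> GLP"
  unfolding GLP_def by (induction rule: theorems_of.induct) (auto intro: theorems_of.intros subst_GLP_axioms)

lemma closed_subst_GLP3:
  assumes "\<phi> \<in> GLP3" and \<sigma>: "\<forall>p. closed_fm (\<sigma> p)"
  shows "subst \<sigma> \<phi> \<in> GLP"
  using assms(1) unfolding GLP3_def
proof (induction rule: theorems_of.induct)
  case (Ax \<phi>)
  then show ?case
  proof
    assume "\<phi> \<in> GLP_axioms"
    then show ?thesis using subst_GLP_axioms GLP.axiom by blast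
  next
    assume "\<phi> \<in> dot3_axioms"
    then show ?thesis by cases (simp add: GLP.closed_dot3 closed_subst \<sigma>)
  qed
qed (auto intro: GLP.MP GLP.Nec)

section \<open>Non-degeneracy and the logic of closed instances\<close>

lemma GLP_non_degenerate: "non_degenerate GLP"
proof -
  have "(Box m ^^ k) \<^bold>\<bottom> \<notin> GLP" for m k
  proof
    assume k: "(Box m ^^ k) \<^bold>\<bottom> \<in> GLP"
    \<comment> \<open>One modality higher than \<open>m\<close>: then \<open>g\<close> and its
      successor \<open>h\<close> agree on all m-boxes, so a power of the box on falsum at
      \<open>g\<close> loses a box on passing to \<open>h\<close> and can be moved back to
      \<open>g\<close>.\<close>
    obtain g where g: "GLP.mcs g" "\<^bold>[Suc m\<^bold>] \<^bold>\<bottom> \<notin> g" using Box_Falsum_notin_GLP GLP.L_iff_mcs by blast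
    obtain h where h: "GLP.R (Suc m) g h" using g GLP.mcs_Box by blast
    have "(Box m ^^ k) \<^bold>\<bottom> \<notin> g" for k
    proof (induction k)
      case 0
      then show ?case using g by simp
    next
      case (Suc k)
      show ?case
      proof
        assume a: "(Box m ^^ Suc k) \<^bold>\<bottom> \<in> g"
        then have b: "(Box m ^^ k) \<^bold>\<bottom> \<in> h" using GLP.R_Box[OF GLP.R_antimono_Suc[OF h]] by simp
        show False
        proof (cases k)
          case 0
          then show False using b GLP.R_mcs(2)[OF h] by simp
        next
          case (Suc j)
          then show False using b GLP.R_Box_iff[OF lessI h] Suc.IH by simp
        qed
      qed
    qed
    then show False using GLP.mcs_L[OF g(1) k] by blast
  qed
  then show ?thesis by (simp add: non_degenerate_def)
qed

lemma Box_power_closed_subst: "subst \<sigma> ((Box m ^^ k) \<^bold>\<bottom>) = (Box m ^^ k) \<^bold>\<bottom>"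
  by (induction k) auto

text \<open>The witness for the extension. It is closed under substitution because a substitution
  followed by a closed one is closed.\<close>

lemma closed_substitutions_normal_extension:
  "normal_extension_of_GLP {\<phi>. closed_substitutions \<phi> \<subseteq> GLP}" (is "normal_extension_of_GLP ?L")
proof -
  have L: "\<phi> \<in> ?L \<longleftrightarrow> (\<forall>\<sigma>. (\<forall>p. closed_fm (\<sigma> p)) \<longrightarrow> subst \<sigma> \<phi> \<in> GLP)" for \<phi>
    unfolding closed_substitutions_eq by blast
  show ?thesis
    unfolding normal_extension_of_GLP_def modal_logic_def
  proof (intro conjI ballI allI impI)
    fix \<phi> \<tau> assume "\<phi> \<in> ?L"
    then show "subst \<tau> \<phi> \<in> ?L" unfolding L by (simp add: subst_subst closed_subst)
  next
    show "GLP \<subseteq> ?L" using L subst_GLP by blast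
  next
    fix \<phi> \<psi> assume "\<phi> \<^bold>\<rightarrow> \<psi> \<in> ?L" "\<phi> \<in> ?L"
    then show "\<psi> \<in> ?L" unfolding L using GLP.MP by simp blast
  next
    fix \<phi> n assume "\<phi> \<in> ?L"
    then show "\<^bold>[n\<^bold>] \<phi> \<in> ?L" unfolding L using GLP.Nec by simp
  qed
qed

lemma closed_substitutions_non_degenerate: "non_degenerate {\<phi>. closed_substitutions \<phi> \<subseteq> GLP}"
  unfolding non_degenerate_def
proof (intro allI notI)
  fix m k assume "(Box m ^^ k) \<^bold>\<bottom> \<in> {\<phi>. closed_substitutions \<phi> \<subseteq> GLP}"
  moreover have "subst (\<lambda>_. \<^bold>\<top>) ((Box m ^^ k) \<^bold>\<bottom>) \<in> closed_substitutions ((Box m ^^ k) \<^bold>\<bottom>)"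
    by (auto simp: closed_substitutions_eq closed_fm_def intro!: exI[of _ "\<lambda>_. \<^bold>\<top>"])
  ultimately show False using GLP_non_degenerate by (auto simp: non_degenerate_def Box_power_closed_subst)
qed

text \<open>A non-theorem \<open>\<phi>\<close> of \<open>GLP3\<close> in \<open>L\<close> would
  bring its refuting instance into \<open>L\<close>, and necessitation by \<open>[0]\<close> would
  then yield falsum under \<open>[m]\<close>.\<close>

lemma non_degenerate_subset_GLP3:
  assumes L: "normal_extension_of_GLP L" "non_degenerate L" and "\<phi> \<in> L"
  shows "\<phi> \<in> GLP3"
proof (rule ccontr)
  assume "\<phi> \<notin> GLP3"
  then obtain \<sigma> m where "\<^bold>[0\<^bold>] subst \<sigma> \<phi> \<^bold>\<rightarrow> \<^bold>[m\<^bold>] \<^bold>\<bottom> \<in> L"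
    using refuting_substitution L(1) unfolding normal_extension_of_GLP_def by blast
  moreover have "\<^bold>[0\<^bold>] subst \<sigma> \<phi> \<in> L"
    using L(1) \<open>\<phi> \<in> L\<close> unfolding normal_extension_of_GLP_def modal_logic_def by blast
  ultimately have "\<^bold>[m\<^bold>] \<^bold>\<bottom> \<in> L" using L(1) unfolding normal_extension_of_GLP_def by blast
  then have "(Box m ^^ 1) \<^bold>\<bottom> \<in> L" by simp
  then show False using L(2) unfolding non_degenerate_def by blast
qed

theorem theoremB:
  fixes \<phi> :: fm
  shows "(\<phi> \<in> GLP3 \<longleftrightarrow> (\<forall>\<psi> \<in> closed_substitutions \<phi>. \<psi> \<in> GLP)) \<and>
         ((\<forall>\<psi> \<in> closed_substitutions \<phi>. \<psi> \<in> GLP) \<longleftrightarrow>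
          (\<exists>L. normal_extension_of_GLP L \<and> non_degenerate L \<and> \<phi> \<in> L))"
proof -
  have 1: "\<forall>\<psi> \<in> closed_substitutions \<phi>. \<psi> \<in> GLP" if "\<phi> \<in> GLP3"
    using closed_subst_GLP3[OF that] by (auto simp: closed_substitutions_eq)
  have 2: "\<exists>L. normal_extension_of_GLP L \<and> non_degenerate L \<and> \<phi> \<in> L"
    if "\<forall>\<psi> \<in> closed_substitutions \<phi>. \<psi> \<in> GLP"
    using that closed_substitutions_normal_extension closed_substitutions_non_degenerate
    by (intro exI[of _ "{\<phi>. closed_substitutions \<phi> \<subseteq> GLP}"]) auto
  show ?thesis using 1 2 non_degenerate_subset_GLP3 by blast
qed

end
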